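(* Let $U\subseteq\mathbb{R}^N$ be open and let $\mathcal{F}$ be a real vector space (under pointwise operations) of $C^\infty$ functions $F:U\to\mathbb{R}^M$ that is ACR. Then almost every $F\in\mathcal{F}$ is $d$-flat with $d=N-\operatorname{maxrank}(\mathcal{F})$; that is, for almost every $F\in\mathcal{F}$, for Lebesgue almost every $p\in U$ the set $\{x\in U:F(x)=F(p)\}$ is a manifold of dimension $d=N-\operatorname{maxrank}(\mathcal{F})$.
   Context: $DF(x)$ is the $M\times N$ Jacobian matrix of $F$ at $x$. $\operatorname{maxrank}(\mathcal{F})=\max_{F\in\mathcal{F},\,x\in U}\operatorname{rank}(DF(x))$. The vector space $\mathcal{F}$ has almost constant rank (is ACR) if for almost every $F\in\mathcal{F}$ and Lebesgue almost every $x\in U$, $\operatorname{rank}(DF(x))=\operatorname{maxrank}(\mathcal{F})$. For $p\in U$, $\operatorname{SolSet}(p)=\{x\in U:F(x)=F(p)\}$; $F$ is $d$-flat if $\operatorname{SolSet}(p)$ is a $d$-dimensional manifold for Lebesgue almost every $p\in U$. "Manifold" means $C^\infty$ manifold without boundary (not necessarily compact or connected); for a subset of $U$ this means an embedded (regular) $C^\infty$ submanifold of $U$. "Almost every $F\in\mathcal{F}$": if $\mathcal{F}$ is finite-dimensional, this is with respect to Lebesgue measure on $\mathcal{F}$. If $\mathcal{F}$ is infinite-dimensional, it is in the sense of prevalence: a set $G\subseteq\mathcal{F}$ is called measurable if $Z\cap G$ is Lebesgue measurable in $Z$ for every finite-dimensional plane (affine subspace) $Z\subseteq\mathcal{F}$;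 almost every element of $\mathcal{F}$ is in a measurable set $G$ if there is a finite-dimensional linear subspace $X\subseteq\mathcal{F}$ such that for every $P\in\mathcal{F}$ and Lebesgue almost every $H\in X$ one has $H+P\in G$. A property holds for almost every $F\in\mathcal{F}$ if it holds for all $F$ in some such measurable $G$. *)

theory Defs
  imports "HOL-Analysis.Analysis" "HOL-Analysis.Embed_Measure" "HOL-Library.Function_Algebras"
begin

text \<open>Pointwise scaling, so that the library's notions for real vector spaces
  (\<open>subspace\<close>, \<open>span\<close>, \<open>independent\<close>) apply to sets of functions.\<close>

instantiation "fun" :: (type, real_vector) real_vector
begin

definition scaleR_fun :: "real \<Rightarrow> ('a \<Rightarrow> 'b) \<Rightarrow> 'a \<Rightarrow> 'b"
  where "scaleR_fun c f = (\<lambda>x. c *\<^sub>R f x)"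

instance
  by standard (simp_all add: scaleR_fun_def fun_eq_iff scaleR_add_left scaleR_add_right)

end


section \<open>Smooth maps\<close>

text \<open>Only meant for open \<open>U\<close>, where \<open>at x\<close> sees only values of \<open>f\<close> on \<open>U\<close>.  All directional
  derivatives of a \<open>C\<^sup>k\<^sup>+\<^sup>1\<close> map are \<open>C\<^sup>k\<close>; in finite dimensions this is the usual
  condition on iterated partial derivatives.\<close>

primrec Ck_on :: "nat \<Rightarrow> 'a::real_normed_vector set \<Rightarrow> ('a \<Rightarrow> 'b::real_normed_vector) \<Rightarrow> bool" where
  "Ck_on 0 U f \<longleftrightarrow> continuous_on U f"
| "Ck_on (Suc k) U f \<longleftrightarrow>
     (\<forall>x\<in>U. f differentiable (at x)) \<and> (\<forall>v. Ck_on k U (\<lambda>x. frechet_derivative f (at x) v))"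

definition smooth_on :: "'a::real_normed_vector set \<Rightarrow> ('a \<Rightarrow> 'b::real_normed_vector) \<Rightarrow> bool"
  where "smooth_on U f \<longleftrightarrow> (\<forall>k. Ck_on k U f)"

text \<open>A function on \<open>U\<close> is represented by its extension by zero: the representatives are in
  linear bijection with the smooth functions on \<open>U\<close>, so spans and dimensions of function
  spaces are the right ones.\<close>

definition smooth_maps :: "'a::real_normed_vector set \<Rightarrow> ('a \<Rightarrow> 'b::real_normed_vector) set"
  where "smooth_maps U = {F. smooth_on U F \<and> (\<forall>x. x \<notin> U \<longrightarrow> F x = 0)}"


section \<open>Lebesgue measure on finite-dimensional planes, and prevalence\<close>

text \<open>Lebesgue measure on the plane \<open>P + span B\<close>, for \<open>B\<close> finite and independent, is carried
  over from the coefficient space.  Measurable sets and null sets do not depend on the choice of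
  \<open>P\<close> and \<open>B\<close> for a given plane; only the scale of the measure does, and it is never used.\<close>

definition plane_param :: "'v::real_vector \<Rightarrow> 'v set \<Rightarrow> ('v \<Rightarrow> real) \<Rightarrow> 'v"
  where "plane_param P B c = P + (\<Sum>b\<in>B. c b *\<^sub>R b)"

definition lebesgue_plane :: "'v::real_vector \<Rightarrow> 'v set \<Rightarrow> 'v measure"
  where "lebesgue_plane P B =
    embed_measure (completion (Pi\<^sub>M B (\<lambda>_. lborel :: real measure))) (plane_param P B)"

lemma inj_on_plane_param:
  assumes "finite B" "independent B"
  shows "inj_on (plane_param P B) (space (completion (Pi\<^sub>M B (\<lambda>_. lborel :: real measure))))"
proof (rule inj_onI)
  fix c d
  assume "c \<in> space (completion (Pi\<^sub>M B (\<lambda>_. lborel :: real measure)))"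
    and "d \<in> space (completion (Pi\<^sub>M B (\<lambda>_. lborel :: real measure)))"
    and eq: "plane_param P B c = plane_param P B d"
  then have c: "c \<in> extensional B" and d: "d \<in> extensional B"
    by (auto simp: space_PiM PiE_iff)
  have "(\<Sum>b\<in>B. (c b - d b) *\<^sub>R b) = 0"
    using eq by (simp add: plane_param_def scaleR_diff_left sum_subtractf)
  then have "c b = d b" if "b \<in> B" for b
    using independentD[OF assms(2) assms(1) subset_refl, of "\<lambda>b. c b - d b"] that by simp
  then show "c = d" using c d by (auto intro: extensionalityI)
qed

lemma space_lebesgue_plane:
  assumes "finite B"
  shows "space (lebesgue_plane P B) = (\<lambda>v. P + v) ` span B"
proof -
  have "(\<lambda>c. \<Sum>b\<in>B. c b *\<^sub>R b) ` (B \<rightarrow>\<^sub>E UNIV) = span B" (is "?f ` _ = _")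
  proof -
    have "?f c \<in> ?f ` (B \<rightarrow>\<^sub>E UNIV)" for c
      by (rule image_eqI[of _ _ "restrict c B"]) (auto intro: sum.cong)
    then have "range ?f = ?f ` (B \<rightarrow>\<^sub>E UNIV)" by blast
    then show ?thesis using span_finite[OF assms] by simp
  qed
  moreover have "plane_param P B ` A = (\<lambda>v. P + v) ` (\<lambda>c. \<Sum>b\<in>B. c b *\<^sub>R b) ` A" for A
    by (auto simp: plane_param_def)
  ultimately show ?thesis
    by (simp add: lebesgue_plane_def space_embed_measure space_PiM)
qed

definition finite_dimensional :: "'v::real_vector set \<Rightarrow> bool"
  where "finite_dimensional V \<longleftrightarrow> (\<exists>B. finite B \<and> span B = V)"

definition plane_measurable :: "'v::real_vector set \<Rightarrow> 'v set \<Rightarrow> bool"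
  where "plane_measurable V G \<longleftrightarrow> G \<subseteq> V \<and>
    (\<forall>P\<in>V. \<forall>B\<subseteq>V. finite B \<and> independent B \<longrightarrow>
       space (lebesgue_plane P B) \<inter> G \<in> sets (lebesgue_plane P B))"

definition prevalent :: "'v::real_vector set \<Rightarrow> 'v set \<Rightarrow> bool"
  where "prevalent V G \<longleftrightarrow> plane_measurable V G \<and>
    (\<exists>B\<subseteq>V. finite B \<and> independent B \<and>
       (\<forall>P\<in>V. AE H in lebesgue_plane 0 B. H + P \<in> G))"

definition almost_every :: "'v::real_vector set \<Rightarrow> ('v \<Rightarrow> bool) \<Rightarrow> bool"
  where "almost_every V Q \<longleftrightarrow>
    (if finite_dimensional V
     then \<exists>B. finite B \<and> independent B \<and> span B = V \<and> (AE F in lebesgue_plane 0 B. Q F)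
     else \<exists>G. prevalent V G \<and> (\<forall>F\<in>G. Q F))"


section \<open>Rank of the Jacobian\<close>

definition maxrank :: "(real^'n) set \<Rightarrow> (real^'n \<Rightarrow> real^'m) set \<Rightarrow> nat"
  where "maxrank U \<F> = Max {rank (jacobian F (at x)) | F x. F \<in> \<F> \<and> x \<in> U}"

definition almost_constant_rank :: "(real^'n) set \<Rightarrow> (real^'n \<Rightarrow> real^'m) set \<Rightarrow> bool"
  where "almost_constant_rank U \<F> \<longleftrightarrow>
    almost_every \<F> (\<lambda>F. AE x in lebesgue_on U. rank (jacobian F (at x)) = maxrank U \<F>)"


section \<open>Submanifolds and flatness\<close>

text \<open>Embedded submanifolds without boundary, given by slice charts: near each of its points, a
  diffeomorphism of open sets of the ambient space straightens \<open>S\<close> to a coordinate subspace.\<close>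

definition embedded_submanifold :: "nat \<Rightarrow> (real^'n) set \<Rightarrow> (real^'n) set \<Rightarrow> bool"
  where "embedded_submanifold d U S \<longleftrightarrow> S \<subseteq> U \<and>
    (\<forall>p\<in>S. \<exists>W V \<phi> \<psi> (I :: 'n set).
       open W \<and> p \<in> W \<and> W \<subseteq> U \<and> open (V :: (real^'n) set) \<and>
       homeomorphism W V \<phi> \<psi> \<and> smooth_on W \<phi> \<and> smooth_on V \<psi> \<and>
       card I = d \<and> \<phi> ` (W \<inter> S) = V \<inter> {y. \<forall>i. i \<notin> I \<longrightarrow> y $ i = 0})"

definition SolSet :: "'a set \<Rightarrow> ('a \<Rightarrow> 'b) \<Rightarrow> 'a \<Rightarrow> 'a set"
  where "SolSet U F p = {x \<in> U. F x = F p}"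

definition flat :: "nat \<Rightarrow> (real^'n) set \<Rightarrow> (real^'n \<Rightarrow> real^'m) \<Rightarrow> bool"
  where "flat d U F \<longleftrightarrow> (AE p in lebesgue_on U. embedded_submanifold d U (SolSet U F p))"

end

theory Submission
  imports Defs
begin

text \<open>
  Let \<open>r\<close> be the maximal rank and \<open>C\<close> the set of points where \<open>DF\<close> has rank below \<open>r\<close>.  A level set that
  avoids \<open>C\<close> is a manifold of dimension \<open>N - r\<close> by the constant rank theorem, so it has to be shown that
  \<open>F\<^sup>-\<^sup>1(F(C))\<close> is null whenever \<open>C\<close> is.  Near a point outside \<open>C\<close> some \<open>r\<close> components of \<open>F\<close> are part of a
  coordinate system; in these coordinates \<open>F\<^sup>-\<^sup>1(F(C))\<close> lies in a cylinder over the critical values of those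
  \<open>r\<close> components, which is null by Sard's theorem.

  Sard's theorem follows from the scalar case: at a critical point some component has a gradient in the
  span of a maximal independent family of the other gradients.  With that family straightened to coordinates,
  its values are, on each line in the direction of the exceptional component, critical values of one
  real function on a slice, and Fubini applies.  In the scalar case (Morse), critical points where all
  derivatives up to order \<open>N\<close> vanish have null image by Taylor's formula; the others lie on a smooth
  hypersurface, to which the induction hypothesis applies.
\<close>

section \<open>Calculus of smooth maps\<close>

text \<open>At a point of an open set the derivative sees only values on that set, so equality on
  \<open>U\<close> passes to all directional derivatives. This lets a formula valid only on
  \<open>U\<close> stand for a derivative.\<close>

lemma Ck_on_cong:
  assumes "open U" "\<And>x. x \<in> U \<Longrightarrow> f x = g x" "Ck_on k U f"
  shows "Ck_on k U g"
  using assms(2,3)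
proof (induction k arbitrary: f g)
  case 0
  then show ?case using continuous_on_cong by force
next
  case (Suc k)
  have d: "(g has_derivative frechet_derivative f (at x)) (at x)" if "x \<in> U" for x
  proof (rule has_derivative_transform_within_open[OF _ \<open>open U\<close> that])
    show "(f has_derivative frechet_derivative f (at x)) (at x)"
      using Suc.prems(2) that by (simp add: frechet_derivative_works)
  qed (use Suc.prems(1) in auto)
  have eq: "frechet_derivative f (at x) = frechet_derivative g (at x)" if "x \<in> U" for x
    using frechet_derivative_at[OF d[OF that]] .
  have "Ck_on k U (\<lambda>x. frechet_derivative g (at x) v)" for v
    by (rule Suc.IH[of "\<lambda>x. frechet_derivative f (at x) v"]) (use eq Suc.prems in auto)
  then show ?case using d by (auto simp: differentiable_def)
qed

text \<open>By uniqueness of derivatives, any explicit formula for the derivative on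
  \<open>U\<close> may replace \<open>frechet_derivative\<close>; the closure properties below are
  proved in this way.\<close>

lemma Ck_on_SucI:
  assumes "open U" "\<And>x. x \<in> U \<Longrightarrow> (f has_derivative f' x) (at x)" "\<And>v. Ck_on k U (\<lambda>x. f' x v)"
  shows "Ck_on (Suc k) U f"
proof -
  have "f' x = frechet_derivative f (at x)" if "x \<in> U" for x
    using frechet_derivative_at[OF assms(2)[OF that]] .
  then have "Ck_on k U (\<lambda>x. frechet_derivative f (at x) v)" for v
    by (intro Ck_on_cong[OF assms(1) _ assms(3)[of v]]) auto
  then show ?thesis using assms(2) by (auto simp: differentiable_def)
qed

lemma Ck_on_SucD:
  assumes "Ck_on (Suc k) U f"
  shows "x \<in> U \<Longrightarrow> (f has_derivative frechet_derivative f (at x)) (at x)"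
    and "Ck_on k U (\<lambda>x. frechet_derivative f (at x) v)"
  using assms by (auto simp: frechet_derivative_works)

lemma Ck_on_decrease: "Ck_on (Suc k) U f \<Longrightarrow> Ck_on k U f"
proof (induction k arbitrary: f)
  case 0
  then show ?case
    by (auto intro!: continuous_at_imp_continuous_on differentiable_imp_continuous_within)
next
  case (Suc k)
  show ?case
    using Suc.prems Suc.IH by (subst Ck_on.simps(2)) (metis Ck_on.simps(2))
qed

lemma Ck_on_subset: "Ck_on k U f \<Longrightarrow> V \<subseteq> U \<Longrightarrow> Ck_on k V f"
  by (induction k arbitrary: f) (auto intro: continuous_on_subset)

lemma Ck_on_const: "Ck_on k U (\<lambda>x. c)"
  by (induction k arbitrary: c) auto

lemma Ck_on_bounded_linear:
  assumes "bounded_linear L" "open U"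
  shows "Ck_on k U f \<Longrightarrow> Ck_on k U (\<lambda>x. L (f x))"
proof (induction k arbitrary: f)
  case 0
  then show ?case using bounded_linear.continuous_on[OF assms(1)] by simp
next
  case (Suc k)
  show ?case
    by (rule Ck_on_SucI[OF assms(2) bounded_linear.has_derivative[OF assms(1) Ck_on_SucD(1)[OF Suc.prems]]])
      (auto intro!: Suc.IH Ck_on_SucD(2) Suc.prems)
qed

lemma Ck_on_add:
  assumes "open U"
  shows "Ck_on k U f \<Longrightarrow> Ck_on k U g \<Longrightarrow> Ck_on k U (\<lambda>x. f x + g x)"
proof (induction k arbitrary: f g)
  case 0
  then show ?case by (simp add: continuous_on_add)
next
  case (Suc k)
  show ?case
    by (rule Ck_on_SucI[OF assms has_derivative_add[OF Ck_on_SucD(1)[OF Suc.prems(1)] Ck_on_SucD(1)[OF Suc.prems(2)]]])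
      (auto intro!: Suc.IH Ck_on_SucD(2) Suc.prems)
qed

lemma Ck_on_bounded_bilinear:
  assumes "bounded_bilinear m" "open U"
  shows "Ck_on k U f \<Longrightarrow> Ck_on k U g \<Longrightarrow> Ck_on k U (\<lambda>x. m (f x) (g x))"
proof (induction k arbitrary: f g)
  case 0
  then show ?case using bounded_bilinear.continuous_on[OF assms(1)] by auto
next
  case (Suc k)
  show ?case
    by (rule Ck_on_SucI[OF assms(2) bounded_bilinear.FDERIV[OF assms(1) Ck_on_SucD(1)[OF Suc.prems(1)] Ck_on_SucD(1)[OF Suc.prems(2)]]])
      (auto intro!: Ck_on_add[OF assms(2)] Suc.IH Ck_on_SucD(2) Suc.prems intro: Ck_on_decrease Suc.prems)
qed

lemmas Ck_on_mult = Ck_on_bounded_bilinear[OF bounded_bilinear_mult]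
lemmas Ck_on_scaleR = Ck_on_bounded_bilinear[OF bounded_bilinear_scaleR]

lemma Ck_on_sum:
  assumes "open U" "\<And>i. i \<in> I \<Longrightarrow> Ck_on k U (f i)"
  shows "Ck_on k U (\<lambda>x. \<Sum>i\<in>I. f i x)"
  using assms(2) by (induction I rule: infinite_finite_induct) (auto intro: Ck_on_const Ck_on_add[OF assms(1)])

lemma Ck_on_prod:
  fixes f :: "'i \<Rightarrow> 'a::real_normed_vector \<Rightarrow> real"
  assumes "open U" "\<And>i. i \<in> I \<Longrightarrow> Ck_on k U (f i)"
  shows "Ck_on k U (\<lambda>x. \<Prod>i\<in>I. f i x)"
  using assms(2) by (induction I rule: infinite_finite_induct) (auto intro: Ck_on_const Ck_on_mult[OF assms(1)])

text \<open>The derivative of \<open>inverse f\<close> is a product that contains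
  \<open>inverse f\<close> itself, already of class k by induction, so regularity is gained one
  order at a time.\<close>

lemma Ck_on_inverse:
  fixes f :: "'a::real_normed_vector \<Rightarrow> real"
  assumes "open U" "\<And>x. x \<in> U \<Longrightarrow> f x \<noteq> 0"
  shows "Ck_on k U f \<Longrightarrow> Ck_on k U (\<lambda>x. inverse (f x))"
proof (induction k)
  case 0
  then show ?case using assms by (auto intro: continuous_on_inverse)
next
  case (Suc k)
  have *: "Ck_on k U (\<lambda>x. inverse (f x))" by (rule Suc.IH[OF Ck_on_decrease[OF Suc.prems]])
  show ?case
  proof (rule Ck_on_SucI[OF assms(1) Deriv.has_derivative_inverse[OF assms(2) Ck_on_SucD(1)[OF Suc.prems]]])
    fix v
    show "Ck_on k U (\<lambda>x. - (inverse (f x) * frechet_derivative f (at x) v * inverse (f x)))"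
      by (intro Ck_on_bounded_linear[OF bounded_linear_minus[OF bounded_linear_ident] assms(1)]
          Ck_on_mult[OF assms(1)] * Ck_on_SucD(2) Suc.prems)
  qed
qed

lemma Ck_on_compose:
  fixes g :: "'a::real_normed_vector \<Rightarrow> 'b::euclidean_space"
  assumes "open U" "g ` U \<subseteq> V"
  shows "Ck_on k U g \<Longrightarrow> Ck_on k V f \<Longrightarrow> Ck_on k U (\<lambda>x. f (g x))"
proof (induction k arbitrary: f)
  case 0
  then show ?case using assms by (auto intro: continuous_on_compose2)
next
  case (Suc k)
  let ?f' = "\<lambda>x. frechet_derivative f (at x)" and ?g' = "\<lambda>x. frechet_derivative g (at x)"
  have df: "(f has_derivative ?f' (g x)) (at (g x))" if "x \<in> U" for x
    using Ck_on_SucD(1)[OF Suc.prems(2)] assms that by blast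
  \<comment> \<open>The direction \<open>?g' x v\<close> moves with x, while \<open>Ck_on\<close>
    speaks of fixed directions. Expanding it in \<open>Basis\<close> leaves finitely many fixed
    directions with coefficients of class k.\<close>
  have eq: "?f' (g x) (?g' x v) = (\<Sum>b\<in>Basis. (?g' x v \<bullet> b) *\<^sub>R ?f' (g x) b)" if "x \<in> U" for x v
  proof -
    interpret linear "?f' (g x)" using df[OF that] by (rule has_derivative_linear)
    show ?thesis
      by (subst euclidean_representation[of "?g' x v", symmetric]) (simp add: sum scaleR del: euclidean_representation)
  qed
  have c: "Ck_on k U (\<lambda>x. (\<Sum>b\<in>Basis. (?g' x v \<bullet> b) *\<^sub>R ?f' (g x) b))" for v
    by (intro Ck_on_sum Ck_on_scaleR Ck_on_bounded_linear[OF bounded_linear_inner_left] Suc.IH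
        Ck_on_decrease[OF Suc.prems(1)] Ck_on_SucD(2) Suc.prems assms)
  show ?case
    by (rule Ck_on_SucI[OF assms(1) has_derivative_compose[OF Ck_on_SucD(1)[OF Suc.prems(1)] df]])
      (auto intro: Ck_on_cong[OF assms(1) _ c] simp: eq)
qed

lemma Ck_on_vec_nth: "open U \<Longrightarrow> Ck_on k U f \<Longrightarrow> Ck_on k U (\<lambda>x. f x $ i)"
  by (rule Ck_on_bounded_linear[OF bounded_linear_vec_nth])

lemma Ck_on_vecI:
  fixes f :: "'a::real_normed_vector \<Rightarrow> real^'n"
  assumes "open U" "\<And>i. Ck_on k U (\<lambda>x. f x $ i)"
  shows "Ck_on k U f"
proof -
  have "Ck_on k U (\<lambda>x. \<Sum>i\<in>UNIV. (f x $ i) *\<^sub>R (axis i 1 :: real^'n))"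
    by (intro Ck_on_sum Ck_on_scaleR assms Ck_on_const)
  then show ?thesis
    by (rule Ck_on_cong[OF assms(1), rotated])
      (simp add: vec_eq_iff axis_def sum_distrib_left if_distrib cong: if_cong)
qed

lemma Ck_on_det:
  fixes A :: "'a::real_normed_vector \<Rightarrow> real^'n^'n"
  assumes "open U" "\<And>i j. Ck_on k U (\<lambda>x. A x $ i $ j)"
  shows "Ck_on k U (\<lambda>x. det (A x))"
  unfolding det_def by (intro Ck_on_sum Ck_on_mult Ck_on_prod Ck_on_const assms)

lemma smooth_onD: "smooth_on U f \<Longrightarrow> Ck_on k U f"
  by (simp add: smooth_on_def)

lemma smooth_on_has_derivative:
  "smooth_on U f \<Longrightarrow> x \<in> U \<Longrightarrow> (f has_derivative frechet_derivative f (at x)) (at x)"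
  using Ck_on_SucD(1) smooth_onD by blast

lemma smooth_on_frechet_derivative: "smooth_on U f \<Longrightarrow> smooth_on U (\<lambda>x. frechet_derivative f (at x) v)"
  unfolding smooth_on_def using Ck_on_SucD(2) by blast

lemma smooth_on_continuous_on: "smooth_on U f \<Longrightarrow> continuous_on U f"
  by (metis Ck_on.simps(1) smooth_on_def)

lemma smooth_on_subset: "smooth_on U f \<Longrightarrow> V \<subseteq> U \<Longrightarrow> smooth_on V f"
  unfolding smooth_on_def using Ck_on_subset by blast

lemma smooth_on_compose:
  fixes g :: "'a::real_normed_vector \<Rightarrow> 'b::euclidean_space"
  shows "open U \<Longrightarrow> g ` U \<subseteq> V \<Longrightarrow> smooth_on U g \<Longrightarrow> smooth_on V f \<Longrightarrow> smooth_on U (\<lambda>x. f (g x))"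
  unfolding smooth_on_def using Ck_on_compose by blast

lemma smooth_on_vecI:
  fixes f :: "'a::real_normed_vector \<Rightarrow> real^'n"
  shows "open U \<Longrightarrow> (\<And>i. smooth_on U (\<lambda>x. f x $ i)) \<Longrightarrow> smooth_on U f"
  unfolding smooth_on_def using Ck_on_vecI by blast

lemma smooth_on_vec_nth: "open U \<Longrightarrow> smooth_on U f \<Longrightarrow> smooth_on U (\<lambda>x. f x $ i)"
  unfolding smooth_on_def using Ck_on_vec_nth by blast

lemma smooth_on_ident: "open U \<Longrightarrow> smooth_on U (\<lambda>x. x)"
proof -
  assume U: "open U"
  have "Ck_on k U (\<lambda>x. x)" for k
  proof (cases k)
    case (Suc k)
    then show ?thesis using Ck_on_SucI[OF U has_derivative_ident Ck_on_const] by simp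
  qed auto
  then show ?thesis by (simp add: smooth_on_def)
qed

section \<open>The inverse function theorem in the smooth category\<close>

text \<open>The classical theorem yields a differentiable inverse whose derivative at y is the
  inverse of that of \<open>f\<close> at \<open>g y\<close>. This formula contains \<open>g\<close>
  only undifferentiated, so an induction lifts \<open>g\<close> through all classes.\<close>

lemma smooth_inverse_function:
  fixes f :: "real^'n \<Rightarrow> real^'n"
  assumes U: "open U" and f: "smooth_on U f" and q: "q \<in> U"
    and inj: "inj (frechet_derivative f (at q))"
  obtains W V g where "open W" "q \<in> W" "W \<subseteq> U" "open V" "homeomorphism W V f g" "smooth_on V g"
proof -
  let ?D = "\<lambda>x. frechet_derivative f (at x)"
  have bl: "bounded_linear (?D x)" if "x \<in> U" for x
    using smooth_on_has_derivative[OF f that] has_derivative_bounded_linear by blast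
  define f' where "f' x = Blinfun (?D x)" for x
  have f': "blinfun_apply (f' x) = ?D x" if "x \<in> U" for x
    unfolding f'_def by (rule bounded_linear_Blinfun_apply[OF bl[OF that]])
  \<comment> \<open>The classical theorem wants continuity in operator norm; in finite dimension
    continuity on each basis vector suffices.\<close>
  have cont: "continuous_on U f'"
  proof (rule continuous_on_blinfun_componentwise)
    fix i :: "real^'n"
    show "continuous_on U (\<lambda>x. blinfun_apply (f' x) i)"
      using smooth_on_continuous_on[OF smooth_on_frechet_derivative[OF f, of i]]
      by (rule continuous_on_cong[THEN iffD1, rotated 2]) (auto simp: f')
  qed
  obtain L where L: "linear L" "L \<circ> ?D q = id"
    using linear_injective_left_inverse[OF bounded_linear.linear[OF bl[OF q]] inj] by blast
  have "bounded_linear L" using L(1) linear_conv_bounded_linear by blast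
  then have "Blinfun L o\<^sub>L f' q = id_blinfun"
    using L(2) f'[OF q] by (intro blinfun_eqI) (simp add: bounded_linear_Blinfun_apply fun_eq_iff)
  with U cont q f' smooth_on_has_derivative[OF f]
  obtain W V g g' where WV: "open W" "W \<subseteq> U" "q \<in> W" "open V" "homeomorphism W V f g"
    and dg: "\<And>y. y \<in> V \<Longrightarrow> (g has_derivative (g' y)) (at y)"
    and g': "\<And>y. y \<in> V \<Longrightarrow> g' y = inv (blinfun_apply (f'(g y)))"
    and bij: "\<And>y. y \<in> V \<Longrightarrow> bij (blinfun_apply (f'(g y)))"
    by (elim inverse_function_theorem[of U f f' q]) auto
  have gV: "g ` V \<subseteq> W" using WV(5) by (auto simp: homeomorphism_def)
  define A where "A y = matrix (?D (g y))" for y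
  have A: "A y *v x = ?D (g y) x" if "y \<in> V" for x y
    unfolding A_def using that gV WV bounded_linear.linear[OF bl] by (simp add: image_subset_iff matrix_works subset_iff)
  have detA: "det (A y) \<noteq> 0" if "y \<in> V" for y
  proof -
    have "inj ((*v) (A y))"
      using bij[OF that] A[OF that] f' gV WV(2) that by (simp add: bij_def inj_on_def image_subset_iff subset_iff)
    then show ?thesis
      by (metis inj_matrix_vector_mult invertible_det_nz invertible_left_inverse matrix_left_invertible_injective)
  qed
  \<comment> \<open>Cramer's rule writes the derivative of \<open>g\<close> rationally in the
    entries of \<open>A\<close>, to which composition, products and inverses of class k
    apply.\<close>
  have g'eq: "g' y v = (\<chi> k. det (\<chi> i j. if j = k then v $ i else A y $ i $ j) * inverse (det (A y)))" if "y \<in> V" for y v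
  proof -
    have "?D (g y) (g' y v) = v"
      using bij[OF that] g'[OF that] f' gV WV(2) that by (simp add: bij_def surj_f_inv_f image_subset_iff subset_iff)
    then have "A y *v (g' y v) = v" using A[OF that] by simp
    then show ?thesis using cramer[OF detA[OF that]] by (simp add: divide_inverse)
  qed
  have "Ck_on k V g" for k
  proof (induction k)
    case 0
    then show ?case using WV(5) by (simp add: homeomorphism_def)
  next
    case (Suc k)
    have Aij: "Ck_on k V (\<lambda>y. A y $ i $ j)" for i j
      unfolding A_def matrix_def vec_lambda_beta
      by (rule Ck_on_compose[where f="\<lambda>x. ?D x (axis j 1) $ i" and V=U])
        (use gV WV in \<open>auto intro!: Suc.IH smooth_onD smooth_on_vec_nth smooth_on_frechet_derivative f U\<close>)
    have "Ck_on k V (\<lambda>y. (\<chi> k. det (\<chi> i j. if j = k then v $ i else A y $ i $ j) * inverse (det (A y))))" for v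
    proof (rule Ck_on_vecI[OF \<open>open V\<close>])
      have "Ck_on k V (\<lambda>y. if j = l then v $ i else A y $ i $ j)" for i j l
        by (cases "j = l") (simp_all add: Ck_on_const Aij)
      then show "Ck_on k V (\<lambda>y. (\<chi> k. det (\<chi> i j. if j = k then v $ i else A y $ i $ j) * inverse (det (A y))) $ l)" for l
        by (auto intro!: Ck_on_mult Ck_on_inverse Ck_on_det Aij \<open>open V\<close> detA)
    qed
    then have "Ck_on k V (\<lambda>y. g' y v)" for v
      by (rule Ck_on_cong[OF \<open>open V\<close>, rotated]) (simp add: g'eq)
    then show ?case by (intro Ck_on_SucI[OF \<open>open V\<close> dg])
  qed
  then show ?thesis using that WV by (simp add: smooth_on_def)
qed

section \<open>Gradients and charts\<close>

definition gradient :: "(real^'n \<Rightarrow> real) \<Rightarrow> real^'n \<Rightarrow> real^'n"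
  where "gradient f x = (\<chi> i. frechet_derivative f (at x) (axis i 1))"

lemma linear_eq_inner:
  fixes L :: "real^'n \<Rightarrow> real"
  assumes "linear L"
  shows "L v = (\<chi> i. L (axis i 1)) \<bullet> v"
proof -
  interpret linear L by fact
  have "v = (\<Sum>i\<in>UNIV. v $ i *\<^sub>R axis i 1)"
    by (simp add: vec_eq_iff axis_def sum_distrib_left if_distrib cong: if_cong)
  then have "L v = L (\<Sum>i\<in>UNIV. v $ i *\<^sub>R axis i 1)" by (rule arg_cong)
  also have "\<dots> = (\<Sum>i\<in>UNIV. v $ i * L (axis i 1))" by (simp add: sum scaleR)
  finally show ?thesis by (simp add: inner_vec_def mult.commute)
qed

lemma frechet_derivative_eq_gradient:
  "smooth_on U f \<Longrightarrow> x \<in> U \<Longrightarrow> frechet_derivative f (at x) v = gradient f x \<bullet> v"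
  unfolding gradient_def
  by (intro linear_eq_inner has_derivative_linear[OF smooth_on_has_derivative])

lemma smooth_on_has_gradient:
  "smooth_on U f \<Longrightarrow> x \<in> U \<Longrightarrow> (f has_derivative (\<lambda>v. gradient f x \<bullet> v)) (at x)"
  using smooth_on_has_derivative[of U f x] frechet_derivative_eq_gradient[of U f x] by (metis (no_types, lifting) ext)

lemma smooth_on_gradient_nth: "smooth_on U f \<Longrightarrow> smooth_on U (\<lambda>x. gradient f x $ i)"
  by (simp add: gradient_def smooth_on_frechet_derivative)

text \<open>The hypothesis \<open>inj\<close> says that the derivative at q of the map with
  components \<open>h i\<close> on \<open>K\<close> and the old coordinates elsewhere has trivial
  kernel, so this map is a local diffeomorphism. All charts below arise in this way.\<close>

lemma replace_coordinates:
  fixes h :: "'n \<Rightarrow> real^'n \<Rightarrow> real"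
  assumes U: "open U" and q: "q \<in> U" and h: "\<And>i. i \<in> K \<Longrightarrow> smooth_on U (h i)"
    and inj: "\<And>v. (\<And>i. i \<in> K \<Longrightarrow> gradient (h i) q \<bullet> v = 0) \<Longrightarrow> (\<And>i. i \<notin> K \<Longrightarrow> v $ i = 0) \<Longrightarrow> v = 0"
  obtains W V \<psi> where "open W" "q \<in> W" "W \<subseteq> U" "open V"
    "homeomorphism W V (\<lambda>x. \<chi> i. if i \<in> K then h i x else x $ i) \<psi>" "smooth_on V \<psi>"
    "smooth_on W (\<lambda>x. \<chi> i. if i \<in> K then h i x else x $ i)"
proof -
  define \<phi> where "\<phi> x = (\<chi> i. if i \<in> K then h i x else x $ i)" for x
  have comp: "smooth_on U (\<lambda>x. \<phi> x $ i)" for i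
    by (cases "i \<in> K") (simp_all add: \<phi>_def h smooth_on_vec_nth U smooth_on_ident)
  then have sm: "smooth_on U \<phi>" by (intro smooth_on_vecI U)
  let ?D = "frechet_derivative \<phi> (at q)"
  have D: "(\<phi> has_derivative ?D) (at q)" by (rule smooth_on_has_derivative[OF sm q])
  have "?D v $ i = (if i \<in> K then gradient (h i) q \<bullet> v else v $ i)" for v i
  proof -
    have 1: "((\<lambda>x. \<phi> x $ i) has_derivative (\<lambda>v. ?D v $ i)) (at q)"
      by (rule bounded_linear.has_derivative[OF bounded_linear_vec_nth D])
    have 2: "((\<lambda>x. \<phi> x $ i) has_derivative (\<lambda>v. if i \<in> K then gradient (h i) q \<bullet> v else v $ i)) (at q)"
      using smooth_on_has_gradient[OF h q] bounded_linear.has_derivative[OF bounded_linear_vec_nth has_derivative_ident]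
      by (cases "i \<in> K") (auto simp: \<phi>_def)
    show ?thesis using has_derivative_unique[OF 1 2] by (rule fun_cong)
  qed
  then have "v = 0" if "?D v = 0" for v
    using that by (intro inj) (metis zero_index)+
  then have "inj ?D" using linear_injective_0[OF has_derivative_linear[OF D]] by blast
  from smooth_inverse_function[OF U sm q this]
  obtain W V g where "open W" "q \<in> W" "W \<subseteq> U" "open V" "homeomorphism W V \<phi> g" "smooth_on V g" .
  with smooth_on_subset[OF sm] show ?thesis
    by (intro that[of W V g]) (simp_all add: \<phi>_def[abs_def])
qed

text \<open>Steinitz exchange: the axes that are not needed to complete \<open>g ` J\<close> to a basis are indexed by \<open>K\<close>.\<close>

lemma independent_family_complete:
  fixes g :: "'k \<Rightarrow> real^'n"
  assumes inj: "inj_on g J" and ind: "independent (g ` J)"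
  obtains K \<tau> where "bij_betw \<tau> K J"
    "\<And>v. (\<And>i. i \<in> K \<Longrightarrow> g (\<tau> i) \<bullet> v = 0) \<Longrightarrow> (\<And>i. i \<notin> K \<Longrightarrow> v $ i = 0) \<Longrightarrow> v = 0"
proof -
  let ?A = "range (\<lambda>i. axis i 1 :: real^'n)"
  obtain B where B: "g ` J \<subseteq> B" "B \<subseteq> g ` J \<union> ?A" "independent B" "g ` J \<union> ?A \<subseteq> span B"
    using maximal_independent_subset_extend[of "g ` J" "g ` J \<union> ?A"] ind by auto
  have "?A = Basis" by (auto simp: Basis_vec_def)
  then have sp: "span B = UNIV" using B(4) by (metis span_Basis span_mono span_span le_sup_iff top.extremum_uniqueI)
  have finB: "finite B" "card B = CARD('n)"
    using B(3) sp by (auto simp: independent_imp_finite dim_eq_card[symmetric])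
     (metis dim_UNIV dim_eq_card DIM_cart DIM_real mult.right_neutral span_UNIV)
  define K where "K = {i. axis i 1 \<notin> B - g ` J}"
  have "bij_betw (\<lambda>i. axis i 1 :: real^'n) (- K) (B - g ` J)"
    unfolding bij_betw_def K_def using B(2) by (auto simp: inj_on_def axis_eq_axis)
  then have "card (- K) = card B - card (g ` J)"
    using bij_betw_same_card card_Diff_subset[OF finite_subset[OF B(1) finB(1)] B(1)] by metis
  moreover have "card (g ` J) \<le> card B" by (rule card_mono[OF finB(1) B(1)])
  moreover have "card K + card (- K) = CARD('n)"
    by (metis card_Un_disjoint Compl_disjoint Compl_partition finite)
  ultimately have "card K = card J" using card_image[OF inj] finB(2) by simp
  moreover have "finite J" using finite_imageD[OF finite_subset[OF B(1) finB(1)] inj] .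
  ultimately obtain \<tau> where \<tau>: "bij_betw \<tau> K J"
    by (meson finite finite_same_card_bij)
  show thesis
  proof (rule that[OF \<tau>])
    fix v assume 1: "\<And>i. i \<in> K \<Longrightarrow> g (\<tau> i) \<bullet> v = 0" and 2: "\<And>i. i \<notin> K \<Longrightarrow> v $ i = 0"
    have "v \<bullet> b = 0" if "b \<in> B" for b
    proof (cases "b \<in> g ` J")
      case True
      then show ?thesis using 1 \<tau> by (metis bij_betw_imp_surj_on image_iff inner_commute)
    next
      case False
      then obtain i where "b = axis i 1" using B(2) \<open>b \<in> B\<close> False by auto
      then have "i \<notin> K" using that False by (simp add: K_def)
      then show ?thesis using 2 \<open>b = axis i 1\<close> by (simp add: inner_axis)
    qed
    then have "orthogonal v w" if "w \<in> span B" for w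
      using orthogonal_to_span[OF that] by (simp add: orthogonal_def)
    then show "v = 0" using sp by (metis UNIV_I orthogonal_self)
  qed
qed

section \<open>Negligible sets\<close>

text \<open>By Lindelof countably many of the neighbourhoods cover \<open>A\<close>. The indexed
  union covers both images, with singletons for \<open>S x\<close>, and unions of cylinders over
  values.\<close>

lemma negligible_locally:
  fixes S :: "'a::second_countable_topology \<Rightarrow> 'b::euclidean_space set"
  assumes "\<And>x. x \<in> A \<Longrightarrow> \<exists>W. open W \<and> x \<in> W \<and> negligible (\<Union>y\<in>A \<inter> W. S y)"
  shows "negligible (\<Union>x\<in>A. S x)"
proof -
  obtain W where W: "\<And>x. x \<in> A \<Longrightarrow> open (W x) \<and> x \<in> W x \<and> negligible (\<Union>y\<in>A \<inter> W x. S y)"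
    using assms by metis
  obtain F where F: "F \<subseteq> W ` A" "countable F" "\<Union>F = \<Union>(W ` A)"
    using Lindelof[of "W ` A"] W by auto
  have "negligible (\<Union>((\<lambda>V. \<Union>y\<in>A \<inter> V. S y) ` F))"
    using F W by (intro negligible_countable_Union) auto
  moreover have "(\<Union>x\<in>A. S x) \<subseteq> \<Union>((\<lambda>V. \<Union>y\<in>A \<inter> V. S y) ` F)"
    using F(3) W by blast
  ultimately show ?thesis by (rule negligible_subset)
qed

text \<open>Averaging over translates by \<open>s *\<^sub>R v\<close>, \<open>s \<in> {0..1}\<close>, gives Fubini along one direction without splitting off a coordinate.\<close>

lemma negligible_lines:
  fixes S :: "'a::euclidean_space set"
  assumes [measurable]: "S \<in> sets borel" and null: "\<And>y. negligible {s::real. s *\<^sub>R v + y \<in> S}"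
  shows "negligible S"
proof -
  have translate: "(\<integral>\<^sup>+y. indicator S (s *\<^sub>R v + y) \<partial>lborel) = emeasure lborel S" for s
  proof -
    have "emeasure lborel S = (\<integral>\<^sup>+y. indicator S y \<partial>distr lborel borel ((+) (s *\<^sub>R v)))"
      by (simp add: lborel_distr_plus)
    also have "\<dots> = (\<integral>\<^sup>+y. indicator S (s *\<^sub>R v + y) \<partial>lborel)"
      by (subst nn_integral_distr) auto
    finally show ?thesis ..
  qed
  have line: "(\<integral>\<^sup>+s. indicator {0..1::real} s * indicator S (s *\<^sub>R v + y) \<partial>lborel) = 0" for y
  proof -
    have "AE s in lborel. s *\<^sub>R v + y \<notin> S"
    proof -
      have [measurable]: "{s. s *\<^sub>R v + y \<in> S} \<in> sets borel" by measurable
      have "{s. s *\<^sub>R v + y \<in> S} \<in> null_sets lborel"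
        using null[of y] by (simp add: negligible_iff_null_sets null_sets_completion_iff)
      from AE_not_in[OF this] show ?thesis by simp
    qed
    then have "(\<integral>\<^sup>+s. indicator {0..1::real} s * indicator S (s *\<^sub>R v + y) \<partial>lborel) = (\<integral>\<^sup>+s. 0 \<partial>(lborel :: real measure))"
      by (intro nn_integral_cong_AE) (auto elim!: eventually_mono)
    then show ?thesis by simp
  qed
  have "emeasure lborel S = (\<integral>\<^sup>+s. indicator {0..1::real} s * emeasure lborel S \<partial>lborel)"
    by (simp add: nn_integral_multc)
  also have "\<dots> = (\<integral>\<^sup>+s. \<integral>\<^sup>+y. indicator {0..1::real} s * indicator S (s *\<^sub>R v + y) \<partial>lborel \<partial>lborel)"
    by (simp add: nn_integral_cmult translate)
  also have "\<dots> = (\<integral>\<^sup>+y. \<integral>\<^sup>+s. indicator {0..1::real} s * indicator S (s *\<^sub>R v + y) \<partial>lborel \<partial>lborel)"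
    by (rule lborel_pair.Fubini'[symmetric]) measurable
  also have "\<dots> = 0" by (simp add: line)
  finally show ?thesis
    by (simp add: negligible_iff_null_sets null_sets_completion_iff null_sets_def)
qed

text \<open>Cut the bounded set into cubes of side 1/N. There are O(N^n) of them and each has its
  image in an interval of length O(N^-(n+1)), so the total length is O(1/N).\<close>

lemma negligible_image_power_dist:
  fixes f :: "real^'n \<Rightarrow> real"
  assumes "bounded A" and f: "\<And>x y. x \<in> A \<Longrightarrow> y \<in> A \<Longrightarrow> \<bar>f x - f y\<bar> \<le> M * norm (x - y) ^ (CARD('n) + 1)"
  shows "negligible (f ` A)"
  unfolding negligible_outer_le
proof (intro allI impI)
  fix e :: real assume e: "e > 0"
  let ?n = "CARD('n)"
  obtain B where B: "B > 0" "\<And>x. x \<in> A \<Longrightarrow> norm x \<le> B"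
    using \<open>bounded A\<close> by (auto simp: bounded_pos)
  \<comment> \<open>The total length of the covering intervals will be at most \<open>C / N\<close>,
    which the choice of \<open>N\<close> makes at most \<open>e\<close>.\<close>
  define C where "C = (2 * B + 3) ^ ?n * (2 * (\<bar>M\<bar> * ?n ^ (?n + 1)))"
  have C: "C \<ge> 0" unfolding C_def using B by (intro mult_nonneg_nonneg) auto
  obtain N :: nat where N: "N > 0" "C / e < N"
    by (metis gr_zeroI of_nat_0_le_iff order_le_less_trans reals_Archimedean2 C divide_nonneg_pos e not_less of_nat_0)
  \<comment> \<open>\<open>k x\<close> labels the cube containing x and \<open>X\<close> holds all
    labels that can occur. \<open>\<delta>\<close> bounds the variation of \<open>f\<close> on one
    cube, whose diameter is estimated by n/N through the sum norm.\<close>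
  define k where "k x = (\<lambda>i. \<lfloor>N * x $ i\<rfloor>)" for x :: "real^'n"
  define b where "b = \<lceil>N * B\<rceil>"
  define X where "X = (UNIV :: 'n set) \<rightarrow>\<^sub>E {- b .. b}"
  define \<delta> where "\<delta> = \<bar>M\<bar> * (?n / N) ^ (?n + 1)"
  \<comment> \<open>The interval is centred at the value of \<open>f\<close> at a chosen point of
    the cube; cubes that miss \<open>A\<close> get the empty set.\<close>
  define T where "T c = (if \<exists>x\<in>A. k x = c then let a = f (SOME x. x \<in> A \<and> k x = c) in cbox (a - \<delta>) (a + \<delta>) else {})" for c
  have kX: "k x \<in> X" if "x \<in> A" for x
  proof -
    have "\<bar>N * x $ i\<bar> \<le> N * B" for i
      using B(2)[OF that] component_le_norm_cart[of x i] N(1) by (simp add: abs_mult)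
    then have "- (N * B) \<le> N * x $ i \<and> N * x $ i \<le> N * B" for i
      by (metis abs_le_iff minus_le_iff)
    then have "- b \<le> \<lfloor>N * x $ i\<rfloor> \<and> \<lfloor>N * x $ i\<rfloor> \<le> b" for i
      unfolding b_def by (smt (verit) le_floor_iff of_int_minus le_of_int_ceiling of_int_floor_le of_int_le_iff)
    then show ?thesis by (auto simp: X_def k_def)
  qed
  have b: "b \<ge> 0" using B N by (simp add: b_def) (smt (verit) mult_nonneg_nonneg of_nat_0_le_iff)
  have cardX: "real (card X) \<le> ((2 * B + 3) * N) ^ ?n"
  proof -
    have "real (card X) = (2 * real_of_int b + 1) ^ ?n"
      using b by (simp add: X_def card_PiE)
    also have "\<dots> \<le> ((2 * B + 3) * N) ^ ?n"
    proof (rule power_mono)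
      have "real_of_int b \<le> N * B + 1" unfolding b_def by linarith
      then have "2 * real_of_int b + 1 \<le> 2 * (N * B) + 3 * 1" by simp
      also have "\<dots> \<le> 2 * (N * B) + 3 * N" using N(1) by simp
      finally show "2 * real_of_int b + 1 \<le> (2 * B + 3) * N" by (simp add: algebra_simps)
    qed (use b in simp)
    finally show ?thesis .
  qed
  have finX: "finite X" unfolding X_def by (intro finite_PiE) auto
  have \<delta>: "\<delta> \<ge> 0" by (simp add: \<delta>_def)
  have close: "\<bar>f x - f y\<bar> \<le> \<delta>" if "x \<in> A" "y \<in> A" "k x = k y" for x y
  proof -
    have "\<bar>(x - y) $ i\<bar> \<le> 1 / N" for i
    proof -
      have "\<lfloor>N * x $ i\<rfloor> = \<lfloor>N * y $ i\<rfloor>" using that(3) by (simp add: k_def fun_eq_iff)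
      then have "\<bar>N * x $ i - N * y $ i\<bar> \<le> 1" by linarith
      then have "N * \<bar>x $ i - y $ i\<bar> \<le> 1" by (simp add: abs_mult flip: right_diff_distrib)
      then show ?thesis using N(1) by (simp add: field_simps)
    qed
    then have "norm (x - y) \<le> (\<Sum>i\<in>(UNIV::'n set). 1 / N)"
      by (intro order_trans[OF norm_le_l1_cart] sum_mono)
    then have "norm (x - y) \<le> ?n / N" by simp
    then have "norm (x - y) ^ (?n + 1) \<le> (?n / N) ^ (?n + 1)" by (intro power_mono) auto
    then have "M * norm (x - y) ^ (?n + 1) \<le> \<delta>"
      unfolding \<delta>_def by (meson abs_ge_self abs_ge_zero mult_mono order_trans zero_le_power norm_ge_zero)
    then show ?thesis using f[OF that(1,2)] by linarith
  qed
  have sub: "f ` A \<subseteq> (\<Union>c\<in>X. T c)"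
  proof clarify
    fix x assume x: "x \<in> A"
    let ?y = "SOME y. y \<in> A \<and> k y = k x"
    have "?y \<in> A \<and> k ?y = k x" by (rule someI[of _ x]) (use x in simp)
    then have "f x \<in> T (k x)" using close[of x ?y] x unfolding T_def by (auto simp: abs_le_iff Let_def)
    then show "f x \<in> (\<Union>c\<in>X. T c)" using kX[OF x] by blast
  qed
  have Tm: "T c \<in> lmeasurable" for c by (auto simp: T_def Let_def)
  have "measure lebesgue (T c) \<le> 2 * \<delta>" for c
    using \<delta> by (auto simp: T_def Let_def)
  then have "(\<Sum>c\<in>X. measure lebesgue (T c)) \<le> card X * (2 * \<delta>)"
    by (metis sum_bounded_above)
  then have "measure lebesgue (\<Union>c\<in>X. T c) \<le> card X * (2 * \<delta>)"
    using measure_UNION_le[OF finX, of T lebesgue] Tm by (meson fmeasurableD order_trans)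
  also have "\<dots> \<le> ((2 * B + 3) * N) ^ ?n * (2 * \<delta>)"
    by (rule mult_right_mono[OF cardX]) (use \<delta> in simp)
  also have "\<dots> = C / N"
    unfolding C_def \<delta>_def power_mult_distrib using N(1) by (simp add: power_divide)
  also have "\<dots> \<le> e" using N e by (simp add: field_simps)
  finally have "measure lebesgue (\<Union>c\<in>X. T c) \<le> e" .
  moreover have "(\<Union>c\<in>X. T c) \<in> lmeasurable" using finX Tm by (intro fmeasurable.finite_UN) auto
  ultimately show "\<exists>T. f ` A \<subseteq> T \<and> T \<in> lmeasurable \<and> measure lebesgue T \<le> e"
    using sub by blast
qed

section \<open>Morse's theorem on slices\<close>

text \<open>The head of the list is differentiated first, so that induction replaces
  \<open>f\<close> by one of its partial derivatives.\<close>

primrec iterated_partial :: "(real^'n \<Rightarrow> real) \<Rightarrow> 'n list \<Rightarrow> real^'n \<Rightarrow> real" where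
  "iterated_partial f [] = f"
| "iterated_partial f (i # \<alpha>) = iterated_partial (\<lambda>x. gradient f x $ i) \<alpha>"

text \<open>Isolates the derivative taken last: a nonzero derivative of least order then appears as
  a partial derivative of one that vanishes.\<close>

lemma iterated_partial_snoc:
  "iterated_partial f (\<alpha> @ [i]) = (\<lambda>x. gradient (iterated_partial f \<alpha>) x $ i)"
  by (induction \<alpha> arbitrary: f) auto

lemma smooth_on_iterated_partial: "smooth_on U f \<Longrightarrow> smooth_on U (iterated_partial f \<alpha>)"
  by (induction \<alpha> arbitrary: f) (auto intro: smooth_on_gradient_nth)

section \<open>Taylor estimates on coordinate slices\<close>

text \<open>Mean value theorem on the segment from x to y, which stays in the slice through x in the
  directions \<open>I\<close>. The bound is demanded only at points no farther from x than y, which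
  lets it depend on that distance in the Taylor induction.\<close>

lemma abs_diff_le_partials:
  fixes f :: "real^'n \<Rightarrow> real"
  assumes f: "smooth_on U f" and S: "convex S" "S \<subseteq> U" "x \<in> S" "y \<in> S"
    and I: "\<And>i. i \<notin> I \<Longrightarrow> y $ i = x $ i"
    and B: "\<And>z i. z \<in> S \<Longrightarrow> (\<And>j. j \<notin> I \<Longrightarrow> z $ j = x $ j) \<Longrightarrow> norm (z - x) \<le> norm (y - x) \<Longrightarrow> i \<in> I \<Longrightarrow>
      \<bar>gradient f z $ i\<bar> \<le> B"
  shows "\<bar>f y - f x\<bar> \<le> CARD('n) * norm (y - x) * B"
proof (cases "x = y")
  case False
  define p where "p t = x + t *\<^sub>R (y - x)" for t :: real
  have pS: "p t \<in> S" if "0 \<le> t" "t \<le> 1" for t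
    using convexD_alt[OF S(1) S(3) S(4) that] by (simp add: p_def algebra_simps)
  have "((\<lambda>t. f (p t)) has_real_derivative gradient f (p t) \<bullet> (y - x)) (at t)" if "0 \<le> t" "t \<le> 1" for t
  proof -
    have "(p has_derivative (\<lambda>s. s *\<^sub>R (y - x))) (at t)"
      unfolding p_def by (auto intro!: derivative_eq_intros)
    moreover have "(f has_derivative (\<lambda>v. gradient f (p t) \<bullet> v)) (at (p t))"
      using smooth_on_has_gradient[OF f] pS[OF that] S(2) by blast
    ultimately have "((\<lambda>t. f (p t)) has_derivative (\<lambda>s. gradient f (p t) \<bullet> s *\<^sub>R (y - x))) (at t)"
      by (rule has_derivative_compose)
    then show ?thesis by (simp add: has_field_derivative_def mult_commute_abs)
  qed
  from MVT2[OF zero_less_one this] obtain t where t: "0 < t" "t < 1"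
    and eq: "f y - f x = gradient f (p t) \<bullet> (y - x)"
    by (auto simp: p_def)
  have pI: "p t $ j = x $ j" if "j \<notin> I" for j using I[OF that] by (simp add: p_def)
  have "norm (p t - x) = t * norm (y - x)" using t by (simp add: p_def)
  then have "norm (p t - x) \<le> norm (y - x)" using t by (simp add: mult_left_le_one_le)
  then have b: "\<bar>gradient f (p t) $ i\<bar> \<le> B" if "i \<in> I" for i
    using B[OF pS pI _ that] t by auto
  \<comment> \<open>As x and y differ, \<open>I\<close> is not empty, and any one of the bounds
    shows that \<open>B\<close> is nonnegative.\<close>
  have "\<exists>i. i \<in> I" using False I by (metis vec_eq_iff)
  then have "B \<ge> 0" using b by force
  have "\<bar>gradient f (p t) \<bullet> (y - x)\<bar> \<le> (\<Sum>i\<in>UNIV. \<bar>gradient f (p t) $ i * (y - x) $ i\<bar>)"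
    unfolding inner_vec_def inner_real_def by (rule sum_abs)
  also have "\<dots> \<le> (\<Sum>i\<in>(UNIV::'n set). B * norm (y - x))"
  proof (rule sum_mono)
    fix i
    show "\<bar>gradient f (p t) $ i * (y - x) $ i\<bar> \<le> B * norm (y - x)"
    proof (cases "i \<in> I")
      case True
      then show ?thesis unfolding abs_mult
        by (intro mult_mono b component_le_norm_cart \<open>B \<ge> 0\<close>) auto
    next
      case False
      then show ?thesis using I \<open>B \<ge> 0\<close> by simp
    qed
  qed
  finally show ?thesis using eq by (simp add: mult_ac)
qed simp

text \<open>Each first partial in a direction of \<open>I\<close> vanishes at x and satisfies the
  hypotheses one order lower, so induction bounds it by a power of the distance; the mean value
  estimate adds one more factor.\<close>

lemma taylor_bound:
  fixes f :: "real^'n \<Rightarrow> real"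
  assumes "smooth_on U f" and S: "convex S" "S \<subseteq> U" "x \<in> S" and "y \<in> S"
    and "\<And>i. i \<notin> I \<Longrightarrow> y $ i = x $ i"
    and "\<And>\<alpha>. set \<alpha> \<subseteq> I \<Longrightarrow> \<alpha> \<noteq> [] \<Longrightarrow> length \<alpha> \<le> k \<Longrightarrow> iterated_partial f \<alpha> x = 0"
    and "\<And>\<alpha> z. set \<alpha> \<subseteq> I \<Longrightarrow> length \<alpha> = Suc k \<Longrightarrow> z \<in> S \<Longrightarrow> \<bar>iterated_partial f \<alpha> z\<bar> \<le> M"
  shows "\<bar>f y - f x\<bar> \<le> M * (CARD('n) * norm (y - x)) ^ Suc k"
  using assms(1,5-)
proof (induction k arbitrary: f y)
  case 0
  have "\<bar>f y - f x\<bar> \<le> CARD('n) * norm (y - x) * M"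
  proof (rule abs_diff_le_partials[OF "0.prems"(1) S "0.prems"(2,3)])
    fix z i assume "z \<in> S" "i \<in> I"
    then show "\<bar>gradient f z $ i\<bar> \<le> M" using "0.prems"(5)[of "[i]"] by simp
  qed
  then show ?case by (simp add: mult_ac)
next
  case (Suc k)
  have "\<bar>f y - f x\<bar> \<le> CARD('n) * norm (y - x) * (M * (CARD('n) * norm (y - x)) ^ Suc k)"
  proof (rule abs_diff_le_partials[OF Suc.prems(1) S Suc.prems(2,3)])
    fix z i assume z: "z \<in> S" "\<And>j. j \<notin> I \<Longrightarrow> z $ j = x $ j" "norm (z - x) \<le> norm (y - x)" and i: "i \<in> I"
    have "gradient f x $ i = 0" using Suc.prems(4)[of "[i]"] i by simp
    then have "\<bar>gradient f z $ i\<bar> = \<bar>gradient f z $ i - gradient f x $ i\<bar>" by simp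
    also have "\<dots> \<le> M * (CARD('n) * norm (z - x)) ^ Suc k"
    proof (rule Suc.IH[OF smooth_on_gradient_nth[OF Suc.prems(1)] z(1,2)])
      fix \<alpha> assume "set \<alpha> \<subseteq> I" "\<alpha> \<noteq> []" "length \<alpha> \<le> k"
      then show "iterated_partial (\<lambda>x. gradient f x $ i) \<alpha> x = 0"
        using Suc.prems(4)[of "i # \<alpha>"] i by simp
    next
      fix \<alpha> z assume "set \<alpha> \<subseteq> I" "length \<alpha> = Suc k" "z \<in> S"
      then show "\<bar>iterated_partial (\<lambda>x. gradient f x $ i) \<alpha> z\<bar> \<le> M"
        using Suc.prems(5)[of "i # \<alpha>" z] i by simp
    qed
    also have "\<dots> \<le> M * (CARD('n) * norm (y - x)) ^ Suc k"
    proof (intro mult_left_mono power_mono)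
      \<comment> \<open>Some list of the right length over \<open>I\<close> is needed to read off
        the sign; repeating i gives one.\<close>
      show "0 \<le> M"
        using Suc.prems(5)[of "replicate (Suc (Suc k)) i" x] i S(3) by (force simp del: replicate_Suc)
    qed (use z in auto)
    finally show "\<bar>gradient f z $ i\<bar> \<le> M * (CARD('n) * norm (y - x)) ^ Suc k" .
  qed
  then show ?case by (simp add: mult_ac)
qed

lemma gradient_compose:
  fixes \<psi> :: "real^'m \<Rightarrow> real^'n"
  assumes "smooth_on U f" "smooth_on V \<psi>" "y \<in> V" "\<psi> y \<in> U"
  shows "gradient (\<lambda>y. f (\<psi> y)) y \<bullet> v = gradient f (\<psi> y) \<bullet> frechet_derivative \<psi> (at y) v"
proof -
  have d: "((\<lambda>y. f (\<psi> y)) has_derivative (\<lambda>v. gradient f (\<psi> y) \<bullet> frechet_derivative \<psi> (at y) v)) (at y)"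
    by (rule has_derivative_compose[OF smooth_on_has_derivative[OF assms(2,3)] smooth_on_has_gradient[OF assms(1,4)]])
  have "gradient (\<lambda>y. f (\<psi> y)) y = (\<chi> i. gradient f (\<psi> y) \<bullet> frechet_derivative \<psi> (at y) (axis i 1))"
    unfolding gradient_def[of "\<lambda>y. f (\<psi> y)"] frechet_derivative_at[OF d, symmetric] ..
  then show ?thesis using linear_eq_inner[OF has_derivative_linear[OF d], of v] by simp
qed

text \<open>For inverse charts that leave some coordinates unchanged: it shows that they carry
  directions along a slice to directions along that slice.\<close>

lemma frechet_derivative_fixed_coordinate:
  fixes \<psi> :: "real^'n \<Rightarrow> real^'n"
  assumes "open V" "smooth_on V \<psi>" "y \<in> V" "\<And>y. y \<in> V \<Longrightarrow> \<psi> y $ i = y $ i"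
  shows "frechet_derivative \<psi> (at y) v $ i = v $ i"
proof -
  have 1: "((\<lambda>y. \<psi> y $ i) has_derivative (\<lambda>v. frechet_derivative \<psi> (at y) v $ i)) (at y)"
    by (rule bounded_linear.has_derivative[OF bounded_linear_vec_nth smooth_on_has_derivative[OF assms(2,3)]])
  have 2: "((\<lambda>y. \<psi> y $ i) has_derivative (\<lambda>v. v $ i)) (at y)"
    by (rule has_derivative_transform_within_open[OF
          bounded_linear.has_derivative[OF bounded_linear_vec_nth has_derivative_ident] assms(1,3)])
      (simp add: assms(4))
  show ?thesis using has_derivative_unique[OF 1 2] by (rule fun_cong)
qed

text \<open>Near each point Taylor's estimate of order n on the slice gives the exponent n + 1 that
  the counting of cubes requires. Using the ambient dimension n for every \<open>I\<close> avoids
  passing to a space of smaller dimension.\<close>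

lemma negligible_flat_values:
  fixes f :: "real^'n \<Rightarrow> real"
  assumes U: "open U" and f: "smooth_on U f"
    and A: "A \<subseteq> U" "\<And>x i. x \<in> A \<Longrightarrow> i \<notin> I \<Longrightarrow> x $ i = c $ i"
      "\<And>x \<alpha>. x \<in> A \<Longrightarrow> set \<alpha> \<subseteq> I \<Longrightarrow> \<alpha> \<noteq> [] \<Longrightarrow> length \<alpha> \<le> CARD('n) \<Longrightarrow> iterated_partial f \<alpha> x = 0"
  shows "negligible (f ` A)"
proof -
  have "negligible (\<Union>x\<in>A. {f x})"
  proof (rule negligible_locally)
    fix x assume "x \<in> A"
    then obtain r where r: "r > 0" "cball x r \<subseteq> U" using U A(1) by (meson open_contains_cball subsetD)
    let ?n = "CARD('n)" and ?L = "{\<alpha>. set \<alpha> \<subseteq> I \<and> length \<alpha> = Suc CARD('n)}"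
    have "compact (\<Union>\<alpha>\<in>?L. iterated_partial f \<alpha> ` cball x r)"
      by (intro compact_UN finite_lists_length_eq compact_continuous_image
          continuous_on_subset[OF smooth_on_continuous_on[OF smooth_on_iterated_partial[OF f]] r(2)]) auto
    then obtain M where M: "\<And>\<alpha> z. \<alpha> \<in> ?L \<Longrightarrow> z \<in> cball x r \<Longrightarrow> \<bar>iterated_partial f \<alpha> z\<bar> \<le> M"
      by (force dest!: compact_imp_bounded simp: bounded_iff)
    have "negligible (f ` (A \<inter> ball x r))"
    proof (rule negligible_image_power_dist)
      show "bounded (A \<inter> ball x r)" by (simp add: bounded_Int)
      fix y z assume yz: "y \<in> A \<inter> ball x r" "z \<in> A \<inter> ball x r"
      have "\<bar>f y - f z\<bar> \<le> M * (?n * norm (y - z)) ^ Suc ?n"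
        by (rule taylor_bound[OF f convex_cball[of x r] r(2), where I = I])
          (use yz A(2,3) M in auto)
      then show "\<bar>f y - f z\<bar> \<le> (M * ?n ^ Suc ?n) * norm (y - z) ^ (?n + 1)"
        by (simp add: power_mult_distrib mult_ac)
    qed
    then show "\<exists>W. open W \<and> x \<in> W \<and> negligible (\<Union>y\<in>A \<inter> W. {f y})"
      using r(1) by (intro exI[of _ "ball x r"]) (simp add: UNION_singleton_eq_range)
  qed
  then show ?thesis by (simp add: UNION_singleton_eq_range)
qed

section \<open>Critical values of a real function\<close>

text \<open>The points are the critical points of \<open>f\<close> restricted to the slice through c
  in the directions \<open>I\<close>. Slices let the dimension \<open>card I\<close> drop in the
  induction while the ambient type stays the same.\<close>

theorem morse_theorem_slice:
  fixes f :: "real^'n \<Rightarrow> real"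
  assumes "open U" "smooth_on U f"
  shows "negligible (f ` {x \<in> U. (\<forall>i. i \<notin> I \<longrightarrow> x $ i = c $ i) \<and> (\<forall>i\<in>I. gradient f x $ i = 0)})"
  using assms
proof (induction "card I" arbitrary: I U f c rule: less_induct)
  case less
  note U = less.prems(1) and f = less.prems(2)
  let ?A = "{x \<in> U. (\<forall>i. i \<notin> I \<longrightarrow> x $ i = c $ i) \<and> (\<forall>i\<in>I. gradient f x $ i = 0)}"
  let ?d = "iterated_partial f"
  define flt where "flt = {x \<in> ?A. \<forall>\<alpha>. set \<alpha> \<subseteq> I \<longrightarrow> \<alpha> \<noteq> [] \<longrightarrow> length \<alpha> \<le> CARD('n) \<longrightarrow> ?d \<alpha> x = 0}"
  \<comment> \<open>These points lie on the zero set of a derivative of \<open>f\<close>, a smooth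
    hypersurface there because its partial derivative in direction i does not vanish.\<close>
  define P where "P \<alpha> i = {x \<in> ?A. ?d \<alpha> x = 0 \<and> gradient (?d \<alpha>) x $ i \<noteq> 0}" for \<alpha> i
  let ?L = "{\<alpha>. set \<alpha> \<subseteq> I \<and> length \<alpha> \<le> CARD('n)}"
  have "?A \<subseteq> flt \<union> (\<Union>\<alpha>\<in>?L. \<Union>i\<in>I. P \<alpha> i)"
  proof
    fix x assume x: "x \<in> ?A"
    let ?Q = "\<lambda>\<beta>. set \<beta> \<subseteq> I \<and> \<beta> \<noteq> [] \<and> length \<beta> \<le> CARD('n) \<and> ?d \<beta> x \<noteq> 0"
    show "x \<in> flt \<union> (\<Union>\<alpha>\<in>?L. \<Union>i\<in>I. P \<alpha> i)"
    proof (cases "\<exists>\<beta>. ?Q \<beta>")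
      case False
      then show ?thesis using x by (auto simp: flt_def)
    next
      case True
      \<comment> \<open>Take a nonzero derivative of least order and drop the differentiation done
        last. What remains is not \<open>f\<close> itself, since x is critical on the slice, so by
        minimality it vanishes at x.\<close>
      then obtain \<beta> where \<beta>: "?Q \<beta>" and least: "\<And>\<alpha>. ?Q \<alpha> \<Longrightarrow> length \<beta> \<le> length \<alpha>"
        using ex_has_least_nat[of ?Q _ length] by metis
      then obtain \<alpha> i where \<alpha>: "\<beta> = \<alpha> @ [i]" by (metis rev_exhaust)
      have i: "i \<in> I" and nz: "gradient (?d \<alpha>) x $ i \<noteq> 0" using \<beta> by (auto simp: \<alpha> iterated_partial_snoc)
      then have "\<alpha> \<noteq> []" using x by auto
      then have "?d \<alpha> x = 0" using \<beta> least[of \<alpha>] by (auto simp: \<alpha>)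
      then have "x \<in> P \<alpha> i" using x nz by (simp add: P_def)
      then show ?thesis using i \<beta> by (auto simp: \<alpha>)
    qed
  qed
  from image_mono[OF this, of f]
  have sub: "f ` ?A \<subseteq> f ` flt \<union> (\<Union>\<alpha>\<in>?L. \<Union>i\<in>I. f ` P \<alpha> i)" by (simp only: image_Un image_UN)
  have "negligible (f ` P \<alpha> i)" if i: "i \<in> I" for \<alpha> i
  proof -
    let ?w = "?d \<alpha>"
    have w: "smooth_on U ?w" by (rule smooth_on_iterated_partial[OF f])
    have "negligible (\<Union>x\<in>P \<alpha> i. {f x})"
    proof (rule negligible_locally)
      fix x assume x: "x \<in> P \<alpha> i"
      then have xU: "x \<in> U" and nz: "gradient ?w x $ i \<noteq> 0" by (auto simp: P_def)
      \<comment> \<open>With \<open>?w\<close> as the new coordinate i, the hypersurface becomes the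
        slice where coordinate i is 0, hence the value 0 in \<open>c'\<close> below and one free
        direction fewer.\<close>
      let ?\<phi> = "\<lambda>x. \<chi> j. if j \<in> {i} then ?w x else x $ j"
      obtain W V \<psi> where W: "open W" "x \<in> W" "W \<subseteq> U" and V: "open V"
        and hom: "homeomorphism W V ?\<phi> \<psi>" and \<psi>: "smooth_on V \<psi>"
      proof (rule replace_coordinates[OF U xU w, where K = "{i}"])
        fix v assume 1: "\<And>j. j \<in> {i} \<Longrightarrow> gradient ?w x \<bullet> v = 0" and 2: "\<And>j. j \<notin> {i} \<Longrightarrow> v $ j = 0"
        have "v = v $ i *\<^sub>R axis i 1" using 2 by (auto simp: vec_eq_iff axis_def)
        then have "gradient ?w x \<bullet> v = v $ i * gradient ?w x $ i"
          by (metis inner_axis inner_real_def inner_scaleR_right mult.right_neutral real_scaleR_def)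
        then have "v $ i = 0" using 1 nz by simp
        then show "v = 0" using 2 by (metis singletonD vec_eq_iff zero_index)
      qed blast
      have \<psi>V: "\<psi> y \<in> W" "?\<phi> (\<psi> y) = y" if "y \<in> V" for y
        using hom that by (auto simp: homeomorphism_def)
      define f' where "f' y = f (\<psi> y)" for y
      define c' where "c' = (\<chi> j. if j = i then 0 else c $ j)"
      let ?A' = "{y \<in> V. (\<forall>j. j \<notin> I - {i} \<longrightarrow> y $ j = c' $ j) \<and> (\<forall>j\<in>I - {i}. gradient f' y $ j = 0)}"
      have f': "smooth_on V f'"
        unfolding f'_def by (rule smooth_on_compose[OF V _ \<psi> f]) (use \<psi>V W in auto)
      have "card (I - {i}) < card I" by (rule card_Diff1_less[OF finite i])
      from less.hyps[OF this V f'] have "negligible (f' ` ?A')" .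
      moreover have "f ` (P \<alpha> i \<inter> W) \<subseteq> f' ` ?A'"
      proof clarify
        fix z assume z: "z \<in> P \<alpha> i" "z \<in> W"
        let ?y = "?\<phi> z"
        have y: "?y \<in> V" "\<psi> ?y = z" using hom z by (auto simp: homeomorphism_def)
        \<comment> \<open>The chart changes only coordinate i, which lies in \<open>I\<close>, so
          the image of axis j points along the old slice, where the gradient of \<open>f\<close> has
          no component.\<close>
        have "gradient f' ?y $ j = 0" if j: "j \<in> I - {i}" for j
        proof -
          let ?u = "frechet_derivative \<psi> (at ?y) (axis j 1)"
          have u: "?u $ l = 0" if "l \<notin> I" for l
          proof -
            have "?u $ l = axis j 1 $ l"
            proof (rule frechet_derivative_fixed_coordinate[OF V \<psi> y(1)])
              fix y assume "y \<in> V"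
              then show "\<psi> y $ l = y $ l" using arg_cong[OF \<psi>V(2), of y "\<lambda>y. y $ l"] that i by (auto split: if_splits)
            qed
            then show ?thesis using j that by (auto simp: axis_def)
          qed
          have "gradient f' ?y $ j = gradient f' ?y \<bullet> axis j 1" by (simp add: inner_axis)
          also have "\<dots> = gradient f z \<bullet> ?u"
            using gradient_compose[OF f \<psi> y(1)] y(2) z W by (auto simp: f'_def[abs_def])
          also have "\<dots> = (\<Sum>l\<in>UNIV. gradient f z $ l * ?u $ l)" by (simp add: inner_vec_def)
          also have "\<dots> = 0"
          proof (rule sum.neutral, rule ballI)
            fix l
            show "gradient f z $ l * ?u $ l = 0"
              using u[of l] z(1) by (cases "l \<in> I") (auto simp: P_def)
          qed
          finally show ?thesis .
        qed
        moreover have "?y $ j = c' $ j" if "j \<notin> I - {i}" for j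
          using that z(1) by (auto simp: P_def c'_def)
        ultimately have "?y \<in> ?A'" using y(1) by blast
        moreover have "f z = f' ?y" by (simp only: f'_def y(2))
        ultimately show "f z \<in> f' ` ?A'" by (rule rev_image_eqI)
      qed
      ultimately have "negligible (f ` (P \<alpha> i \<inter> W))" by (rule negligible_subset)
      then show "\<exists>W. open W \<and> x \<in> W \<and> negligible (\<Union>y\<in>P \<alpha> i \<inter> W. {f y})"
        using W by (intro exI[of _ W]) (simp add: UNION_singleton_eq_range)
    qed
    then show ?thesis by (simp add: UNION_singleton_eq_range)
  qed
  then have "negligible (\<Union>i\<in>I. f ` P \<alpha> i)" for \<alpha>
    by (intro negligible_Union finite_imageI finite) auto
  moreover have "finite ?L" by (rule finite_lists_length_le) simp
  ultimately have "negligible (\<Union>\<alpha>\<in>?L. \<Union>i\<in>I. f ` P \<alpha> i)"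
    by (intro negligible_Union finite_imageI) (auto simp only: image_iff)
  moreover have "negligible (f ` flt)"
    by (rule negligible_flat_values[OF U f, of _ I c]) (auto simp: flt_def)
  ultimately show ?case by (intro negligible_subset[OF _ sub] negligible_Un)
qed

section \<open>Sard's theorem\<close>

text \<open>Where \<open>g\<close> is a coordinate of the chart inverse to \<psi>, both sides
  differentiate the same function: the columns of the derivative of \<psi> are dual to the gradients
  of the new coordinates.\<close>

lemma gradient_dual:
  fixes \<psi> :: "real^'n \<Rightarrow> real^'n"
  assumes V: "open V" and g: "smooth_on U g" and \<psi>: "smooth_on V \<psi>" and y: "y \<in> V" and \<psi>V: "\<psi> ` V \<subseteq> U"
    and eq: "\<And>y. y \<in> V \<Longrightarrow> g (\<psi> y) = y $ i"
  shows "gradient g (\<psi> y) \<bullet> frechet_derivative \<psi> (at y) v = v $ i"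
proof -
  have 1: "((\<lambda>y. g (\<psi> y)) has_derivative (\<lambda>v. gradient g (\<psi> y) \<bullet> frechet_derivative \<psi> (at y) v)) (at y)"
    using y \<psi>V
    by (intro has_derivative_compose[OF smooth_on_has_derivative[OF \<psi> y] smooth_on_has_gradient[OF g]]) auto
  have 2: "((\<lambda>y. g (\<psi> y)) has_derivative (\<lambda>v. v $ i)) (at y)"
    by (rule has_derivative_transform_within_open[OF
          bounded_linear.has_derivative[OF bounded_linear_vec_nth has_derivative_ident] V y])
      (simp add: eq)
  show ?thesis using has_derivative_unique[OF 1 2] by (rule fun_cong)
qed

lemma inner_span_eq_0:
  assumes "a \<in> span B" "\<And>b. b \<in> B \<Longrightarrow> b \<bullet> u = 0"
  shows "a \<bullet> u = (0::real)"
  using orthogonal_to_span[of a B u] assms by (simp add: orthogonal_def inner_commute)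

text \<open>Straighten the functions of \<open>K\<close> to the coordinates in \<open>L\<close>. On
  \<open>C\<close> the remaining function \<open>h i0\<close> then has zero partial derivatives
  outside \<open>L\<close>, so on each line in direction \<open>i0\<close> the slice theorem
  applies. Target coordinates outside \<open>insert i0 K\<close> stay free.\<close>

lemma negligible_cylinder_dependent_value:
  fixes h :: "'k::finite \<Rightarrow> real^'n \<Rightarrow> real"
  assumes U: "open U" and h: "\<And>i. i \<in> insert i0 K \<Longrightarrow> smooth_on U (h i)" and i0: "i0 \<notin> K"
  defines "C \<equiv> {q \<in> U. inj_on (\<lambda>i. gradient (h i) q) K \<and> independent ((\<lambda>i. gradient (h i) q) ` K) \<and>
    gradient (h i0) q \<in> span ((\<lambda>i. gradient (h i) q) ` K)}"
  shows "negligible (\<Union>q\<in>C. {z :: real^'k. \<forall>i\<in>insert i0 K. z $ i = h i q})"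
proof (rule negligible_locally)
  fix q assume "q \<in> C"
  then have q: "q \<in> U" and ind: "inj_on (\<lambda>i. gradient (h i) q) K" "independent ((\<lambda>i. gradient (h i) q) ` K)"
    by (auto simp: C_def)
  obtain L \<tau> where \<tau>: "bij_betw \<tau> L K"
    and inj: "\<And>v. (\<And>i. i \<in> L \<Longrightarrow> gradient (h (\<tau> i)) q \<bullet> v = 0) \<Longrightarrow> (\<And>i. i \<notin> L \<Longrightarrow> v $ i = 0) \<Longrightarrow> v = 0"
    using independent_family_complete[OF ind] by metis
  have \<tau>K: "\<tau> l \<in> K" if "l \<in> L" for l using \<tau> that bij_betwE by blast
  let ?\<phi> = "\<lambda>x. \<chi> i. if i \<in> L then h (\<tau> i) x else x $ i"
  obtain W V \<psi> where W: "open W" "q \<in> W" "W \<subseteq> U" and V: "open V"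
    and hom: "homeomorphism W V ?\<phi> \<psi>" and \<psi>: "smooth_on V \<psi>"
    by (rule replace_coordinates[OF U q, of L "\<lambda>i. h (\<tau> i)"]) (use h \<tau>K inj in blast)+
  have \<phi>W: "?\<phi> x \<in> V" "\<psi> (?\<phi> x) = x" if "x \<in> W" for x
    using hom that by (auto simp: homeomorphism_def)
  have \<psi>V: "\<psi> y \<in> W" "?\<phi> (\<psi> y) = y" if "y \<in> V" for y
    using hom that by (auto simp: homeomorphism_def)
  have \<psi>U: "\<psi> ` V \<subseteq> U" using \<psi>V(1) W(3) by blast
  have h\<psi>: "h (\<tau> l) (\<psi> y) = y $ l" if "l \<in> L" "y \<in> V" for l y
    using arg_cong[OF \<psi>V(2)[OF that(2)], of "\<lambda>y. y $ l"] that by simp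
  define f where "f y = h i0 (\<psi> y)" for y
  have f: "smooth_on V f"
    unfolding f_def by (rule smooth_on_compose[OF V \<psi>U \<psi> h]) simp
  define y0 where "y0 = ?\<phi> q"
  obtain r where r: "r > 0" "cball y0 r \<subseteq> V"
    using V \<phi>W(1)[OF W(2)] by (metis open_contains_cball y0_def)
  \<comment> \<open>A compact set of critical points containing the relevant part of
    \<open>C\<close> in the chart; compactness makes the cylinder over its values closed, hence
    Borel as Fubini requires.\<close>
  define D where "D = {y \<in> cball y0 r. \<forall>j\<in>-L. gradient f y $ j = 0}"
  have contgrad: "continuous_on (cball y0 r) (\<lambda>y. gradient f y $ j)" for j
    by (rule continuous_on_subset[OF smooth_on_continuous_on[OF smooth_on_gradient_nth[OF f]] r(2)])
  have "compact D"
  proof -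
    have "D = cball y0 r \<inter> (\<Inter>j\<in>-L. {y \<in> cball y0 r. gradient f y $ j = 0})" by (auto simp: D_def)
    moreover have "closed {y \<in> cball y0 r. gradient f y $ j = 0}" for j
      by (rule continuous_closed_preimage_constant[OF contgrad closed_cball])
    ultimately show ?thesis by (auto intro!: compact_Int_closed)
  qed
  define \<sigma> where "\<sigma> = inv_into L \<tau>"
  have \<sigma>: "\<sigma> (\<tau> l) = l" if "l \<in> L" for l
    unfolding \<sigma>_def by (rule bij_betw_inv_into_left[OF \<tau> that])
  \<comment> \<open>\<open>H\<close> lists the constrained target coordinates of the point y and
    \<open>T\<close> erases the free ones, so \<open>T -\<close> (H \<open>D)\<close> is the
    cylinder over the values on \<open>D\<close>.\<close>
  define H where "H y = (\<chi> i. if i = i0 then f y else if i \<in> K then y $ \<sigma> i else 0)" for y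
  define T where "T z = (\<chi> i. if i \<in> insert i0 K then z $ i else 0)" for z :: "real^'k"
  have "continuous_on D H"
    unfolding H_def
  proof (rule continuous_on_vec_lambda)
    fix i
    have "continuous_on D f"
      by (rule continuous_on_subset[OF smooth_on_continuous_on[OF f]]) (use r in \<open>auto simp: D_def\<close>)
    then show "continuous_on D (\<lambda>y. if i = i0 then f y else if i \<in> K then y $ \<sigma> i else 0)"
      by (cases "i = i0"; cases "i \<in> K") (auto intro!: continuous_intros)
  qed
  then have "compact (H ` D)" using \<open>compact D\<close> by (rule compact_continuous_image)
  moreover have "continuous_on UNIV T"
    unfolding T_def
  proof (rule continuous_on_vec_lambda)
    fix i
    show "continuous_on UNIV (\<lambda>z :: real^'k. if i \<in> insert i0 K then z $ i else 0)"
      by (cases "i \<in> insert i0 K") (auto intro!: continuous_intros)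
  qed
  ultimately have closed: "closed (T -` (H ` D))"
    by (intro closed_vimage compact_imp_closed)
  have "negligible (T -` (H ` D))"
  proof (rule negligible_lines)
    show "T -` (H ` D) \<in> sets borel" using closed by (rule borel_closed)
    fix w
    \<comment> \<open>Along the line the coordinates in \<open>K\<close> are constant, which pins
      the coordinates of y in \<open>L\<close> to those of \<open>c\<close>. Coordinate
      \<open>i0\<close> then runs through critical values of \<open>f\<close> on that slice.\<close>
    define c :: "real^'n" where "c = (\<chi> l. w $ \<tau> l)"
    let ?A = "f ` {y \<in> V. (\<forall>i. i \<notin> - L \<longrightarrow> y $ i = c $ i) \<and> (\<forall>i\<in>- L. gradient f y $ i = 0)}"
    have "negligible ((+) (- w $ i0) ` ?A)"
      by (intro negligible_translation morse_theorem_slice V f)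
    moreover have "{s. s *\<^sub>R axis i0 1 + w \<in> T -` (H ` D)} \<subseteq> (+) (- w $ i0) ` ?A"
    proof
      fix s assume "s \<in> {s. s *\<^sub>R axis i0 1 + w \<in> T -` (H ` D)}"
      then obtain y where y: "y \<in> D" and eq: "T (s *\<^sub>R axis i0 1 + w) = H y" by auto
      have "T (s *\<^sub>R axis i0 1 + w) $ i0 = s + w $ i0" by (simp add: T_def)
      then have s: "s + w $ i0 = f y" by (simp add: eq H_def)
      have "y $ l = c $ l" if "l \<in> L" for l
      proof -
        have K: "\<tau> l \<in> K" "\<tau> l \<noteq> i0" using \<tau>K[OF that] i0 by auto
        then have "T (s *\<^sub>R axis i0 1 + w) $ \<tau> l = w $ \<tau> l" by (simp add: T_def axis_def)
        then show ?thesis using K \<sigma>[OF that] by (simp add: eq H_def c_def)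
      qed
      then have "f y \<in> ?A" using y r(2) by (intro imageI) (auto simp: D_def)
      then show "s \<in> (+) (- w $ i0) ` ?A" by (rule rev_image_eqI) (simp add: s[symmetric])
    qed
    ultimately show "negligible {s. s *\<^sub>R axis i0 1 + w \<in> T -` (H ` D)}" by (rule negligible_subset)
  qed
  moreover
  \<comment> \<open>Points of this smaller neighbourhood land in the ball on which \<open>D\<close>
    was formed.\<close>
  define W' where "W' = W \<inter> ?\<phi> -` ball y0 r"
  have "(\<Union>q\<in>C \<inter> W'. {z. \<forall>i\<in>insert i0 K. z $ i = h i q}) \<subseteq> T -` (H ` D)"
  proof clarify
    fix x z assume x: "x \<in> C" "x \<in> W'" and z: "\<forall>i\<in>insert i0 K. z $ i = h i x"
    define y where "y = ?\<phi> x"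
    have xW: "x \<in> W" using x(2) by (simp add: W'_def)
    have y: "y \<in> V" "\<psi> y = x" "y \<in> ball y0 r"
      using \<phi>W[OF xW] x(2) by (simp_all add: y_def W'_def)
    \<comment> \<open>By duality column j of the derivative of \<psi> is orthogonal to all gradients
      of the family \<open>K\<close>, hence also to the one in their span.\<close>
    have "gradient f y $ j = 0" if j: "j \<notin> L" for j
    proof -
      let ?u = "frechet_derivative \<psi> (at y) (axis j 1)"
      have "gradient (h i) x \<bullet> ?u = 0" if i: "i \<in> K" for i
      proof -
        obtain l where l: "l \<in> L" "i = \<tau> l" using i bij_betw_imp_surj_on[OF \<tau>] by blast
        have "gradient (h i) (\<psi> y) \<bullet> ?u = axis j 1 $ l"
          by (rule gradient_dual[OF V h \<psi> y(1) \<psi>U]) (use i h\<psi> l in auto)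
        then show ?thesis using y j l by (auto simp: axis_def)
      qed
      then have *: "b \<bullet> ?u = 0" if "b \<in> (\<lambda>i. gradient (h i) x) ` K" for b using that by blast
      have "gradient (h i0) x \<in> span ((\<lambda>i. gradient (h i) x) ` K)" using x(1) by (simp add: C_def)
      then have "gradient (h i0) x \<bullet> ?u = 0" using * by (rule inner_span_eq_0)
      moreover have "gradient f y \<bullet> axis j 1 = gradient (h i0) (\<psi> y) \<bullet> ?u"
        unfolding f_def[abs_def] by (rule gradient_compose[OF h \<psi> y(1)]) (use y xW W in auto)
      ultimately show ?thesis by (simp add: y inner_axis)
    qed
    then have "y \<in> D" using y by (auto simp: D_def)
    moreover have "T z = H y"
    proof -
      have "y $ \<sigma> i = h i x" if i: "i \<in> K" for i
      proof -
        obtain l where l: "l \<in> L" "i = \<tau> l" using i bij_betw_imp_surj_on[OF \<tau>] by blast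
        then show ?thesis using \<sigma>[OF l(1)] by (simp add: y_def)
      qed
      then show ?thesis using z by (auto simp: T_def H_def vec_eq_iff f_def y)
    qed
    ultimately show "z \<in> T -` (H ` D)" by auto
  qed
  moreover have "open W'"
    unfolding W'_def using hom W(1) by (intro continuous_open_preimage) (auto simp: homeomorphism_def)
  moreover have "q \<in> W'" using W r by (simp add: W'_def y0_def)
  ultimately show "\<exists>W. open W \<and> q \<in> W \<and> negligible (\<Union>y\<in>C \<inter> W. {z. \<forall>i\<in>insert i0 K. z $ i = h i y})"
    by (meson negligible_subset)
qed

text \<open>Where the gradients are dependent, a maximal independent subfamily \<open>J\<close>
  misses some \<open>i0\<close>, whose gradient lies in the span of the others. There are finitely
  many pairs of \<open>J\<close> and \<open>i0\<close>. Equal gradients with different indices count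
  as dependent, hence \<open>inj_on\<close>.\<close>

theorem sard_cylinder:
  fixes h :: "'k::finite \<Rightarrow> real^'n \<Rightarrow> real"
  assumes U: "open U" and h: "\<And>i. i \<in> K \<Longrightarrow> smooth_on U (h i)"
  shows "negligible {z :: real^'k. \<exists>q\<in>U. (\<forall>i\<in>K. z $ i = h i q) \<and>
    \<not> (inj_on (\<lambda>i. gradient (h i) q) K \<and> independent ((\<lambda>i. gradient (h i) q) ` K))}"
proof -
  let ?ind = "\<lambda>q K. inj_on (\<lambda>i. gradient (h i) q) K \<and> independent ((\<lambda>i. gradient (h i) q) ` K)"
  define C where "C J i0 = {q \<in> U. inj_on (\<lambda>i. gradient (h i) q) J \<and> independent ((\<lambda>i. gradient (h i) q) ` J) \<and>
    gradient (h i0) q \<in> span ((\<lambda>i. gradient (h i) q) ` J)}" for J i0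
  define Z where "Z J i0 = (\<Union>q\<in>C J i0. {z :: real^'k. \<forall>i\<in>insert i0 J. z $ i = h i q})" for J i0
  have Z: "negligible (Z J i0)" if "J \<subseteq> K" "i0 \<in> K - J" for J i0
    unfolding Z_def C_def by (rule negligible_cylinder_dependent_value[OF U h]) (use that in auto)
  have "negligible (\<Union>J\<in>Pow K. \<Union>i0\<in>K - J. Z J i0)"
    by (intro negligible_Union finite_imageI) (auto simp only: image_iff Pow_iff finite intro!: negligible_Union Z)
  moreover have "{z :: real^'k. \<exists>q\<in>U. (\<forall>i\<in>K. z $ i = h i q) \<and> \<not> ?ind q K} \<subseteq> (\<Union>J\<in>Pow K. \<Union>i0\<in>K - J. Z J i0)"
  proof clarify
    fix z :: "real^'k" and q assume q: "q \<in> U" and z: "\<forall>i\<in>K. z $ i = h i q" and nind: "\<not> ?ind q K"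
    have "{} \<in> {J. J \<subseteq> K \<and> ?ind q J}" by (simp add: independent_empty)
    then obtain J where J: "J \<subseteq> K" "?ind q J" and max: "\<And>J'. J' \<subseteq> K \<Longrightarrow> ?ind q J' \<Longrightarrow> J \<subseteq> J' \<Longrightarrow> J = J'"
      using finite_has_maximal2[of "{J. J \<subseteq> K \<and> ?ind q J}" "{}"] by auto
    have "J \<noteq> K" using J(2) nind by metis
    then obtain i0 where i0: "i0 \<in> K - J" using J(1) by blast
    have "gradient (h i0) q \<in> span ((\<lambda>i. gradient (h i) q) ` J)"
    proof (rule ccontr)
      assume n: "\<not> ?thesis"
      then have "?ind q (insert i0 J)"
        using J i0 independent_insertI[OF n] by (auto simp: inj_on_insert intro: span_base)
      then show False using max[of "insert i0 J"] J i0 by blast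
    qed
    then have "z \<in> Z J i0" using q J z i0 by (auto simp: Z_def C_def)
    then show "z \<in> (\<Union>J\<in>Pow K. \<Union>i0\<in>K - J. Z J i0)" using J i0 by blast
  qed
  ultimately show ?thesis by (rule negligible_subset)
qed

section \<open>Level sets\<close>

lemma rank_jacobian:
  fixes F :: "real^'n \<Rightarrow> real^'m"
  assumes F: "smooth_on U F" and x: "x \<in> U"
  shows "rank (jacobian F (at x)) = dim (range (\<lambda>j. gradient (\<lambda>x. F x $ j) x))"
proof -
  have "row j (jacobian F (at x)) = gradient (\<lambda>x. F x $ j) x" for j
  proof -
    have "((\<lambda>x. F x $ j) has_derivative (\<lambda>v. frechet_derivative F (at x) v $ j)) (at x)"
      by (rule bounded_linear.has_derivative[OF bounded_linear_vec_nth smooth_on_has_derivative[OF F x]])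
    from frechet_derivative_at[OF this, symmetric] show ?thesis
      by (simp add: gradient_def jacobian_def matrix_def row_def vec_eq_iff)
  qed
  then have "rows (jacobian F (at x)) = range (\<lambda>j. gradient (\<lambda>x. F x $ j) x)"
    by (auto simp: rows_def)
  then show ?thesis by (simp add: row_rank_def)
qed

text \<open>Choose components of \<open>F\<close> whose gradients form a basis of the row space at p
  and complete them to coordinates; \<open>\<tau>\<close> tells which component replaces which
  coordinate.\<close>

lemma rank_chart:
  fixes F :: "real^'n \<Rightarrow> real^'m"
  assumes U: "open U" and F: "smooth_on U F" and p: "p \<in> U"
  obtains L \<tau> W V \<psi> where "inj_on \<tau> L" "card L = rank (jacobian F (at p))"
    "open W" "p \<in> W" "W \<subseteq> U" "open V"
    "homeomorphism W V (\<lambda>x. \<chi> i. if i \<in> L then F x $ \<tau> i else x $ i) \<psi>" "smooth_on V \<psi>"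
    "smooth_on W (\<lambda>x. \<chi> i. if i \<in> L then F x $ \<tau> i else x $ i)"
proof -
  let ?g = "\<lambda>j. gradient (\<lambda>x. F x $ j) p"
  obtain B where B: "B \<subseteq> range ?g" "independent B" "card B = dim (range ?g)"
    using basis_exists[of "range ?g"] by metis
  then obtain J where J: "inj_on ?g J" "B = ?g ` J" using subset_image_inj[of B ?g UNIV] by blast
  obtain L \<tau> where \<tau>: "bij_betw \<tau> L J"
    and inj: "\<And>v. (\<And>i. i \<in> L \<Longrightarrow> ?g (\<tau> i) \<bullet> v = 0) \<Longrightarrow> (\<And>i. i \<notin> L \<Longrightarrow> v $ i = 0) \<Longrightarrow> v = 0"
    using independent_family_complete[OF J(1)] B(2) J(2) by metis
  have card: "card L = rank (jacobian F (at p))"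
    using bij_betw_same_card[OF \<tau>] card_image[OF J(1)] J(2) B(3) rank_jacobian[OF F p] by simp
  have smooth: "smooth_on U (\<lambda>x. F x $ \<tau> i)" if "i \<in> L" for i by (rule smooth_on_vec_nth[OF U F])
  show thesis
    by (rule replace_coordinates[OF U p, of L "\<lambda>i x. F x $ \<tau> i", OF smooth inj])
      ((rule that[OF bij_betw_imp_inj_on[OF \<tau>] card]; assumption) | blast)+
qed

text \<open>Near p of full rank, \<open>L\<close> indexes r components of \<open>F\<close> used as
  coordinates. If x shares its value with a point q of low rank, anywhere in \<open>U\<close>, the
  gradients of these components are dependent at q, so the chart sends x into a null cylinder. The
  differentiable inverse chart preserves null sets.\<close>

lemma negligible_meets_low_rank:
  fixes F :: "real^'n \<Rightarrow> real^'m"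
  assumes U: "open U" and F: "smooth_on U F" and r: "\<And>x. x \<in> U \<Longrightarrow> rank (jacobian F (at x)) \<le> r"
    and null: "negligible {x \<in> U. rank (jacobian F (at x)) < r}"
  shows "negligible {p \<in> U. \<exists>q\<in>U. F q = F p \<and> rank (jacobian F (at q)) < r}"
proof -
  let ?C = "{x \<in> U. rank (jacobian F (at x)) < r}"
  define E where "E = {p \<in> U. \<exists>q\<in>U. F q = F p \<and> rank (jacobian F (at q)) < r} - ?C"
  have "negligible (\<Union>p\<in>E. {p})"
  proof (rule negligible_locally)
    fix p assume p: "p \<in> E"
    then have pU: "p \<in> U" and rp: "rank (jacobian F (at p)) = r"
      using r[of p] by (auto simp: E_def)
    let ?\<phi> = "\<lambda>L \<tau> x. \<chi> i. if i \<in> L then F x $ \<tau> i else x $ i"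
    from rank_chart[OF U F pU]
    obtain L \<tau> W V \<psi> where \<tau>: "inj_on \<tau> L" and cardL: "card L = rank (jacobian F (at p))"
      and W: "open W" "p \<in> W" "W \<subseteq> U" and V: "open V"
      and hom: "homeomorphism W V (?\<phi> L \<tau>) \<psi>" and \<psi>: "smooth_on V \<psi>"
      and "smooth_on W (?\<phi> L \<tau>)" .
    note cardL = cardL[unfolded rp]
    let ?g = "\<lambda>q i. gradient (\<lambda>x. F x $ \<tau> i) q"
    \<comment> \<open>Equality of the values at x and q fixes only the coordinates in
      \<open>L\<close> of the chart point of x; the others are free, so a cylinder over critical
      values is needed.\<close>
    define Z :: "(real^'n) set" where "Z = {z. \<exists>q\<in>U. (\<forall>i\<in>L. z $ i = F q $ \<tau> i) \<and>
      \<not> (inj_on (?g q) L \<and> independent (?g q ` L))}"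
    have "negligible Z"
      unfolding Z_def by (rule sard_cylinder[OF U smooth_on_vec_nth[OF U F]])
    then have "negligible (V \<inter> Z)" by (rule negligible_subset) simp
    moreover have "\<psi> differentiable_on V \<inter> Z"
      using smooth_on_has_derivative[OF \<psi>]
      by (auto simp: differentiable_on_def differentiable_def intro: has_derivative_at_withinI)
    ultimately have "negligible (\<psi> ` (V \<inter> Z))"
      by (rule negligible_differentiable_image_negligible[OF order_refl])
    moreover have "E \<inter> W \<subseteq> \<psi> ` (V \<inter> Z)"
    proof
      fix x assume x: "x \<in> E \<inter> W"
      then obtain q where q: "q \<in> U" "F q = F x" "rank (jacobian F (at q)) < r" by (auto simp: E_def)
      have dep: "\<not> (inj_on (?g q) L \<and> independent (?g q ` L))"
      proof
        assume ind: "inj_on (?g q) L \<and> independent (?g q ` L)"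
        have "r = card (?g q ` L)" using ind card_image cardL by metis
        also have "\<dots> \<le> dim (range (\<lambda>j. gradient (\<lambda>x. F x $ j) q))"
          by (rule independent_card_le_dim) (use ind in auto)
        finally show False using q rank_jacobian[OF F q(1)] by simp
      qed
      have "?\<phi> L \<tau> x \<in> Z"
        unfolding Z_def mem_Collect_eq by (rule bexI[OF _ q(1)]) (use dep q(2) in simp)
      moreover have "?\<phi> L \<tau> x \<in> V" "\<psi> (?\<phi> L \<tau> x) = x" using hom x by (auto simp: homeomorphism_def)
      ultimately show "x \<in> \<psi> ` (V \<inter> Z)" by (intro rev_image_eqI[of "?\<phi> L \<tau> x"]) simp_all
    qed
    ultimately have "negligible (\<Union>p\<in>E \<inter> W. {p})" by (simp add: negligible_subset)
    then show "\<exists>W. open W \<and> p \<in> W \<and> negligible (\<Union>p\<in>E \<inter> W. {p})" using W by blast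
  qed
  then have "negligible (?C \<union> E)" using null by (simp add: negligible_Un)
  then show ?thesis by (rule negligible_subset) (auto simp: E_def)
qed

text \<open>Pairing with \<open>d i\<close> gives 1 on \<open>g i\<close> and 0 on the span of the
  others.\<close>

lemma independent_of_dual:
  fixes g d :: "'i \<Rightarrow> 'a::euclidean_space"
  assumes "\<And>i j. i \<in> L \<Longrightarrow> j \<in> L \<Longrightarrow> g i \<bullet> d j = (if i = j then 1 else 0)"
  shows "inj_on g L" and "independent (g ` L)"
proof -
  show inj: "inj_on g L" by (rule inj_onI) (metis assms zero_neq_one)
  show "independent (g ` L)"
    unfolding dependent_def
  proof clarify
    fix i assume i: "i \<in> L" and sp: "g i \<in> span (g ` L - {g i})"
    have "g i \<bullet> d i = 0" by (rule inner_span_eq_0[OF sp]) (use assms i in auto)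
    then show False using assms i by simp
  qed
qed

section \<open>The constant rank theorem for a level set\<close>

text \<open>In the chart the chosen gradients stay independent, and since the rank at q is maximal
  they span all gradients. So every component of \<open>F\<close> depends only on the coordinates in
  \<open>L\<close> on a ball, and its zero set is where these vanish.\<close>

lemma slice_chart_zero_set:
  fixes F :: "real^'n \<Rightarrow> real^'m"
  assumes U: "open U" and F: "smooth_on U F" and q: "q \<in> U" "F q = 0"
    and r: "\<And>x. x \<in> U \<Longrightarrow> rank (jacobian F (at x)) \<le> rank (jacobian F (at q))"
  shows "\<exists>W V \<phi> \<psi> (I :: 'n set).
       open W \<and> q \<in> W \<and> W \<subseteq> U \<and> open (V :: (real^'n) set) \<and>
       homeomorphism W V \<phi> \<psi> \<and> smooth_on W \<phi> \<and> smooth_on V \<psi> \<and>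
       card I = CARD('n) - rank (jacobian F (at q)) \<and>
       \<phi> ` (W \<inter> {x \<in> U. F x = 0}) = V \<inter> {y. \<forall>i. i \<notin> I \<longrightarrow> y $ i = 0}"
proof -
  from rank_chart[OF U F q(1)]
  obtain L \<tau> W V \<psi> where \<tau>: "inj_on \<tau> L" and cardL: "card L = rank (jacobian F (at q))"
    and W: "open W" "q \<in> W" "W \<subseteq> U" and V: "open V"
    and hom: "homeomorphism W V (\<lambda>x. \<chi> i. if i \<in> L then F x $ \<tau> i else x $ i) \<psi>" and \<psi>: "smooth_on V \<psi>"
    and sm: "smooth_on W (\<lambda>x. \<chi> i. if i \<in> L then F x $ \<tau> i else x $ i)" .
  define \<phi> where "\<phi> x = (\<chi> i. if i \<in> L then F x $ \<tau> i else x $ i)" for x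
  note hom = hom[folded \<phi>_def[abs_def]] and sm = sm[folded \<phi>_def[abs_def]]
  have \<phi>L: "\<phi> x $ i = F x $ \<tau> i" if "i \<in> L" for x i using that by (simp add: \<phi>_def)
  have \<psi>V: "\<psi> y \<in> W" "\<phi> (\<psi> y) = y" if "y \<in> V" for y using hom that by (auto simp: homeomorphism_def)
  have \<psi>U: "\<psi> ` V \<subseteq> U" using \<psi>V W by blast
  have \<phi>q: "\<phi> q \<in> V" "\<psi> (\<phi> q) = q" using hom W by (auto simp: homeomorphism_def)
  \<comment> \<open>A ball is convex, so vanishing partial derivatives give constancy along each
    slice.\<close>
  obtain e where e: "e > 0" "ball (\<phi> q) e \<subseteq> V" using V \<phi>q(1) by (meson open_contains_ball)
  have Fj: "smooth_on U (\<lambda>x. F x $ j)" for j by (rule smooth_on_vec_nth[OF U F])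
  have F\<psi>: "smooth_on V (\<lambda>y. F (\<psi> y) $ j)" for j by (rule smooth_on_compose[OF V \<psi>U \<psi> Fj])
  have grad0: "gradient (\<lambda>y. F (\<psi> y) $ j) y $ l = 0" if y: "y \<in> V" and l: "l \<notin> L" for y j l
  proof -
    let ?g = "\<lambda>j. gradient (\<lambda>x. F x $ j) (\<psi> y)"
    let ?D = "\<lambda>i. frechet_derivative \<psi> (at y) (axis i 1)"
    have dual: "?g (\<tau> i) \<bullet> ?D l = axis l 1 $ i" if "i \<in> L" for i l
      by (rule gradient_dual[OF V Fj \<psi> y \<psi>U]) (metis \<phi>L \<psi>V(2) that)
    have dual': "?g (\<tau> i) \<bullet> ?D l = (if i = l then 1 else 0)" if "i \<in> L" for i l
      unfolding dual[OF that] by (simp add: axis_def)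
    note ind = independent_of_dual[of L "\<lambda>i. ?g (\<tau> i)" ?D, OF dual']
    have "\<psi> y \<in> U" using \<psi>U y by blast
    then have "dim (range ?g) \<le> card ((\<lambda>i. ?g (\<tau> i)) ` L)"
      using r[of "\<psi> y"] rank_jacobian[OF F, of "\<psi> y"] card_image[OF ind(1)] cardL by simp
    then have "range ?g \<subseteq> span ((\<lambda>i. ?g (\<tau> i)) ` L)"
      by (intro card_ge_dim_independent ind(2)) auto
    then have "?g j \<in> span ((\<lambda>i. ?g (\<tau> i)) ` L)" by blast
    then have "?g j \<bullet> ?D l = 0"
    proof (rule inner_span_eq_0)
      fix b assume "b \<in> (\<lambda>i. ?g (\<tau> i)) ` L"
      then obtain i where "i \<in> L" "b = ?g (\<tau> i)" by blast
      then show "b \<bullet> ?D l = 0" using dual'[of i l] l by auto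
    qed
    moreover have "gradient (\<lambda>y. F (\<psi> y) $ j) y \<bullet> axis l 1 = ?g j \<bullet> ?D l"
      by (rule gradient_compose[OF Fj \<psi> y \<open>\<psi> y \<in> U\<close>])
    ultimately show ?thesis by (simp add: inner_axis)
  qed
  have zero: "F (\<psi> y) = 0" if y: "y \<in> ball (\<phi> q) e" "\<And>i. i \<in> L \<Longrightarrow> y $ i = 0" for y
  proof -
    \<comment> \<open>Both points have zero coordinates in \<open>L\<close>, and the partial
      derivatives in the other directions vanish, so the mean value estimate holds with bound
      0.\<close>
    have "\<bar>F (\<psi> y) $ j - F (\<psi> (\<phi> q)) $ j\<bar> \<le> CARD('n) * norm (y - \<phi> q) * 0" for j
      by (rule abs_diff_le_partials[OF F\<psi> convex_ball e(2), where I = "- L"])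
        (use y e grad0 in \<open>auto simp: \<phi>L q\<close>)
    then show ?thesis by (simp add: \<phi>q q vec_eq_iff)
  qed
  define W' where "W' = W \<inter> \<phi> -` ball (\<phi> q) e"
  have oW': "open W'"
    unfolding W'_def using hom W(1) by (intro continuous_open_preimage) (auto simp: homeomorphism_def)
  have "\<phi> ` W' = ball (\<phi> q) e"
  proof (intro equalityI subsetI)
    fix y assume y: "y \<in> ball (\<phi> q) e"
    then have "\<psi> y \<in> W'" using \<psi>V[of y] e(2) by (simp add: W'_def subset_iff)
    then show "y \<in> \<phi> ` W'" using y \<psi>V(2)[of y] e(2) by (intro rev_image_eqI[of "\<psi> y"]) auto
  qed (auto simp: W'_def)
  then have "homeomorphism W' (ball (\<phi> q) e) \<phi> \<psi>"
    by (intro homeomorphism_of_subsets[OF hom _ order_refl]) (auto simp: W'_def)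
  moreover have "\<phi> ` (W' \<inter> {x \<in> U. F x = 0}) = ball (\<phi> q) e \<inter> {y. \<forall>i. i \<notin> - L \<longrightarrow> y $ i = 0}"
  proof (intro equalityI subsetI)
    fix y assume "y \<in> \<phi> ` (W' \<inter> {x \<in> U. F x = 0})"
    then show "y \<in> ball (\<phi> q) e \<inter> {y. \<forall>i. i \<notin> - L \<longrightarrow> y $ i = 0}" by (auto simp: W'_def \<phi>L)
  next
    fix y assume y: "y \<in> ball (\<phi> q) e \<inter> {y. \<forall>i. i \<notin> - L \<longrightarrow> y $ i = 0}"
    then have yV: "y \<in> V" using e by blast
    have "F (\<psi> y) = 0" using zero y by simp
    then have "\<psi> y \<in> W' \<inter> {x \<in> U. F x = 0}" using \<psi>V[OF yV] y W by (auto simp: W'_def)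
    then show "y \<in> \<phi> ` (W' \<inter> {x \<in> U. F x = 0})" using \<psi>V(2)[OF yV] by (intro rev_image_eqI[of "\<psi> y"]) simp_all
  qed
  moreover have "card (- L) = CARD('n) - rank (jacobian F (at q))"
    unfolding cardL[symmetric] by (simp add: Compl_eq_Diff_UNIV card_Diff_subset)
  moreover have "q \<in> W'" "W' \<subseteq> U" "smooth_on W' \<phi>" "smooth_on (ball (\<phi> q) e) \<psi>"
    using W e smooth_on_subset[OF sm, of W'] smooth_on_subset[OF \<psi> e(2)] by (auto simp: W'_def)
  ultimately show ?thesis using oW'
    by (intro exI[of _ W'] exI[of _ "ball (\<phi> q) e"] exI[of _ \<phi>] exI[of _ \<psi>] exI[of _ "- L"]) auto
qed

lemma smooth_on_diff_const:
  assumes "open U" "smooth_on U f"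
  shows "smooth_on U (\<lambda>x. f x - c)"
proof -
  have "Ck_on k U (\<lambda>x. f x + - c)" for k
    by (intro Ck_on_add Ck_on_const smooth_onD assms)
  then show ?thesis by (simp add: smooth_on_def)
qed

lemma jacobian_diff_const:
  assumes "smooth_on U F" "x \<in> U"
  shows "jacobian (\<lambda>x. F x - c) (at x) = jacobian F (at x)"
proof -
  have "((\<lambda>x. F x - c) has_derivative frechet_derivative F (at x)) (at x)"
    using has_derivative_diff[OF smooth_on_has_derivative[OF assms] has_derivative_const[of c]] by simp
  from frechet_derivative_at[OF this] show ?thesis by (simp add: jacobian_def)
qed

section \<open>From one map to almost every map\<close>

text \<open>For p outside a null set, no point on the level set of p has low rank, so each of them
  has the maximal rank r. Subtracting the constant \<open>F p\<close> turns the level set into a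
  zero set with the same Jacobian.\<close>

theorem flat_if_rank_ae:
  fixes F :: "real^'n \<Rightarrow> real^'m"
  assumes U: "open U" and F: "smooth_on U F" and r: "\<And>x. x \<in> U \<Longrightarrow> rank (jacobian F (at x)) \<le> r"
    and ae: "AE x in lebesgue_on U. rank (jacobian F (at x)) = r"
  shows "flat (CARD('n) - r) U F"
proof -
  have Um: "U \<inter> space lebesgue \<in> sets lebesgue" using U by simp
  have "AE x in lebesgue. x \<in> U \<longrightarrow> rank (jacobian F (at x)) = r"
    using ae AE_restrict_space_iff[OF Um] by simp
  then have "AE x in lebesgue. x \<notin> {x \<in> U. rank (jacobian F (at x)) < r}"
    by (rule eventually_mono) auto
  then obtain N where "N \<in> null_sets lebesgue" "{x \<in> U. rank (jacobian F (at x)) < r} \<subseteq> N"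
    by (auto simp: eventually_ae_filter)
  then have "negligible {x \<in> U. rank (jacobian F (at x)) < r}"
    unfolding negligible_iff_null_sets[symmetric] by (rule negligible_subset)
  note null = negligible_meets_low_rank[OF U F r this]
  have "embedded_submanifold (CARD('n) - r) U (SolSet U F p)"
    if p: "p \<notin> {p \<in> U. \<exists>q\<in>U. F q = F p \<and> rank (jacobian F (at q)) < r}" "p \<in> U" for p
    unfolding embedded_submanifold_def
  proof (intro conjI ballI)
    fix q assume "q \<in> SolSet U F p"
    then have q: "q \<in> U" "F q = F p" by (auto simp: SolSet_def)
    then have rq: "rank (jacobian F (at q)) = r" using p r[of q] by (auto simp: not_less order_antisym)
    have S: "{x \<in> U. F x - F p = 0} = SolSet U F p" by (simp add: SolSet_def)
    have jac: "jacobian (\<lambda>x. F x - F p) (at x) = jacobian F (at x)" if "x \<in> U" for x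
      by (rule jacobian_diff_const[OF F that])
    have 1: "F q - F p = 0" by (simp add: q)
    have 2: "rank (jacobian (\<lambda>x. F x - F p) (at x)) \<le> rank (jacobian (\<lambda>x. F x - F p) (at q))" if "x \<in> U" for x
      using r[OF that] by (simp add: jac[OF that] jac[OF q(1)] rq)
    show "\<exists>W V \<phi> \<psi> (I :: 'n set).
       open W \<and> q \<in> W \<and> W \<subseteq> U \<and> open (V :: (real^'n) set) \<and>
       homeomorphism W V \<phi> \<psi> \<and> smooth_on W \<phi> \<and> smooth_on V \<psi> \<and>
       card I = CARD('n) - r \<and> \<phi> ` (W \<inter> SolSet U F p) = V \<inter> {y. \<forall>i. i \<notin> I \<longrightarrow> y $ i = 0}"
      using slice_chart_zero_set[OF U smooth_on_diff_const[OF U F] q(1) 1 2]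
      unfolding jac[OF q(1)] rq S .
  qed (auto simp: SolSet_def)
  moreover have "AE p in lebesgue. p \<notin> {p \<in> U. \<exists>q\<in>U. F q = F p \<and> rank (jacobian F (at q)) < r}"
    by (rule AE_not_in) (use null in \<open>simp add: negligible_iff_null_sets\<close>)
  ultimately have "AE p in lebesgue. p \<in> U \<longrightarrow> embedded_submanifold (CARD('n) - r) U (SolSet U F p)"
    by (rule_tac eventually_mono) auto
  then show ?thesis unfolding flat_def using AE_restrict_space_iff[OF Um] by simp
qed

text \<open>Membership in \<open>V\<close> may be assumed because \<open>V\<close> is the whole
  space of the plane measure in finite dimension and contains every prevalent set otherwise.\<close>

lemma almost_every_mono:
  assumes "almost_every V Q" "\<And>F. F \<in> V \<Longrightarrow> Q F \<Longrightarrow> R F"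
  shows "almost_every V R"
proof (cases "finite_dimensional V")
  case True
  then obtain B where B: "finite B" "independent B" "span B = V" "AE F in lebesgue_plane 0 B. Q F"
    using assms(1) by (auto simp: almost_every_def)
  have "AE F in lebesgue_plane 0 B. F \<in> V"
    using B(3) space_lebesgue_plane[OF B(1), of 0] AE_space[of "lebesgue_plane 0 B"] by simp
  with B(4) have "AE F in lebesgue_plane 0 B. R F" by eventually_elim (rule assms(2))
  then show ?thesis using True B by (auto simp: almost_every_def intro!: exI[of _ B])
next
  case False
  then obtain G where G: "prevalent V G" "\<forall>F\<in>G. Q F"
    using assms(1) by (auto simp: almost_every_def)
  then have "G \<subseteq> V" by (simp add: prevalent_def plane_measurable_def)
  then have "\<forall>F\<in>G. R F" using G(2) assms(2) by blast
  then show ?thesis using False G(1) by (auto simp: almost_every_def)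
qed

theorem corollary5:
  fixes U :: "(real^'n) set" and \<F> :: "(real^'n \<Rightarrow> real^'m) set"
  assumes "open U"
    and "\<F> \<subseteq> smooth_maps U"
    and "subspace \<F>"
    and "almost_constant_rank U \<F>"
  shows "almost_every \<F> (flat (CARD('n) - maxrank U \<F>) U)"
proof (rule almost_every_mono[OF assms(4)[unfolded almost_constant_rank_def]])
  fix F assume F: "F \<in> \<F>" and ae: "AE x in lebesgue_on U. rank (jacobian F (at x)) = maxrank U \<F>"
  \<comment> \<open>Ranks are bounded by the number of columns, so \<open>Max\<close> in
    \<open>maxrank\<close> is taken over a finite set and bounds each rank.\<close>
  have "finite {rank (jacobian F (at x)) | F x. F \<in> \<F> \<and> x \<in> U}"
    by (rule finite_subset[of _ "{..CARD('n)}"]) (auto intro: order_trans[OF rank_bound])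
  then have le: "rank (jacobian F (at x)) \<le> maxrank U \<F>" if "x \<in> U" for x
    unfolding maxrank_def using F that by (intro Max_ge) auto
  show "flat (CARD('n) - maxrank U \<F>) U F"
    by (rule flat_if_rank_ae[OF assms(1) _ le ae]) (use F assms(2) in \<open>auto simp: smooth_maps_def\<close>)
qed

end
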